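(* Let $(z,z',w,w')$ be admissible and $N\ge1$. Let $P_{z,z',w,w'\mid N}(t)$ be the Feller semigroup on $\mathbb S_N$ obtained by transporting, via the bijection $\nu\mapsto\mathbf n$ with $n_i=\nu_i+N-i$, the Feller semigroup on $\Omega_N$ whose generator is $D_{z,z',w,w'\mid N}$ with domain $\{f\in C_0(\Omega_N):D_{z,z',w,w'\mid N}f\in C_0(\Omega_N)\}$. Then the zw-measure $M_{z,z',w,w'\mid N}$ is a stationary distribution of the corresponding Feller process. That is, for all $t\ge0$ and $f\in C_0(\mathbb S_N)$, $$\sum_\nu M_{z,z',w,w'\mid N}(\nu)\,(P_{z,z',w,w'\mid N}(t)f)(\nu)=\sum_\nu M_{z,z',w,w'\mid N}(\nu)f(\nu).$$
   Context: Signatures and the state space: - $\mathbb S_N$ is the set of integer $N$-tuples $\nu_1\ge\dots\ge\nu_N$. - $\Omega_N=\{\mathbf n\in\mathbb Z^N:n_1>\dots>n_N\}$. - $V(\mathbf n)=\prod_{i<j}(n_i-n_j)$, and $\epsilon_k$ is the $k$th basis vector. The difference operator: $$(D_{z,z',w,w'\mid N}f)(\mathbf n)=\sum_{k=1}^N\Big(\frac{V(\mathbf n+\epsilon_k)}{V(\mathbf n)}(z+N-1-n_k)(z'+N-1-n_k)(f(\mathbf n+\epsilon_k)-f(\mathbf n))+\frac{V(\mathbf n-\epsilon_k)}{V(\mathbf n)}(w+n_k)(w'+n_k)(f(\mathbf n-\epsilon_k)-f(\mathbf n))\Big).$$ Such a Feller semigroup exists for admissible parameters. Admissibility: $(z,z',w,w')$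 is admissible if both of the following hold: - $(z+k)(z'+k)>0$ and $(w+k)(w'+k)>0$ for all $k\in\mathbb Z$; - $\mathrm{Re}(z+z'+w+w')>-1$. The zw-measure: - $\mathrm{Dim}_N\nu=\prod_{i<j}\frac{\nu_i-\nu_j-i+j}{j-i}$. - $M_{z,z',w,w'\mid N}(\nu)$ is proportional to $$\prod_{i=1}^N\frac{1}{\Gamma(z-\nu_i+i)\Gamma(z'-\nu_i+i)\Gamma(w+N+1+\nu_i-i)\Gamma(w'+N+1+\nu_i-i)}\,(\mathrm{Dim}_N\nu)^2,$$ normalized to be a probability measure on $\mathbb S_N$. *)

theory Defs
  imports "HOL-Analysis.Analysis"
begin

section \<open>State spaces (0-based list indices; entry j corresponds to index i = j+1)\<close>

definition Omega :: "nat \<Rightarrow> int list set" where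
  "Omega N = {n. length n = N \<and> sorted_wrt (>) n}"

definition Sig :: "nat \<Rightarrow> int list set" where
  "Sig N = {\<nu>. length \<nu> = N \<and> sorted_wrt (\<ge>) \<nu>}"

definition sig_to_n :: "nat \<Rightarrow> int list \<Rightarrow> int list" where
  "sig_to_n N \<nu> = map (\<lambda>j. \<nu> ! j + int (N - 1 - j)) [0..<N]"

definition n_to_sig :: "nat \<Rightarrow> int list \<Rightarrow> int list" where
  "n_to_sig N n = map (\<lambda>j. n ! j - int (N - 1 - j)) [0..<N]"

definition vdm :: "int list \<Rightarrow> real" where
  "vdm n = (\<Prod>(i, j) \<in> {(i, j). i < j \<and> j < length n}. real_of_int (n ! i - n ! j))"

definition shift :: "int list \<Rightarrow> nat \<Rightarrow> int \<Rightarrow> int list" where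
  "shift n k d = n[k := n ! k + d]"

text \<open>The operator D on functions Omega_N to R. For admissible parameters the
  products (z+N-1-n_k)(z'+N-1-n_k) and (w+n_k)(w'+n_k) are real; we take Re.
  Functions are represented as total functions on int list (vanishing outside
  the state space).\<close>
definition zw_D :: "complex \<Rightarrow> complex \<Rightarrow> complex \<Rightarrow> complex \<Rightarrow> nat \<Rightarrow>
    (int list \<Rightarrow> real) \<Rightarrow> int list \<Rightarrow> real" where
  "zw_D z z' w w' N f n =
    (\<Sum>k<N.
       vdm (shift n k 1) / vdm n
         * Re ((z + of_nat N - 1 - of_int (n ! k)) * (z' + of_nat N - 1 - of_int (n ! k)))
         * (f (shift n k 1) - f n)
     + vdm (shift n k (-1)) / vdm n
         * Re ((w + of_int (n ! k)) * (w' + of_int (n ! k)))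
         * (f (shift n k (-1)) - f n))"

definition zw_gen :: "complex \<Rightarrow> complex \<Rightarrow> complex \<Rightarrow> complex \<Rightarrow> nat \<Rightarrow>
    (int list \<Rightarrow> real) \<Rightarrow> int list \<Rightarrow> real" where
  "zw_gen z z' w w' N f = (\<lambda>n. if n \<in> Omega N then zw_D z z' w w' N f n else 0)"

definition admissible :: "complex \<Rightarrow> complex \<Rightarrow> complex \<Rightarrow> complex \<Rightarrow> bool" where
  "admissible z z' w w' \<longleftrightarrow>
     (\<forall>k::int. (z + of_int k) * (z' + of_int k) \<in> \<real> \<and> Re ((z + of_int k) * (z' + of_int k)) > 0) \<and>
     (\<forall>k::int. (w + of_int k) * (w' + of_int k) \<in> \<real> \<and> Re ((w + of_int k) * (w' + of_int k)) > 0) \<and>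
     Re (z + z' + w + w') > -1"

definition C0 :: "'a set \<Rightarrow> ('a \<Rightarrow> real) \<Rightarrow> bool" where
  "C0 X f \<longleftrightarrow> (\<forall>x. x \<notin> X \<longrightarrow> f x = 0) \<and> (\<forall>e>0. finite {x \<in> X. \<bar>f x\<bar> \<ge> e})"

definition supnorm :: "'a set \<Rightarrow> ('a \<Rightarrow> real) \<Rightarrow> real" where
  "supnorm X f = (SUP x\<in>X. \<bar>f x\<bar>)"

definition feller_semigroup :: "'a set \<Rightarrow> (real \<Rightarrow> ('a \<Rightarrow> real) \<Rightarrow> 'a \<Rightarrow> real) \<Rightarrow> bool" where
  "feller_semigroup X Q \<longleftrightarrow>
     (\<forall>t\<ge>0. \<forall>f. C0 X f \<longrightarrow> C0 X (Q t f)) \<and>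
     (\<forall>t\<ge>0. \<forall>f g a b. C0 X f \<and> C0 X g \<longrightarrow>
         Q t (\<lambda>x. a * f x + b * g x) = (\<lambda>x. a * Q t f x + b * Q t g x)) \<and>
     (\<forall>f. C0 X f \<longrightarrow> Q 0 f = f) \<and>
     (\<forall>s\<ge>0. \<forall>t\<ge>0. \<forall>f. C0 X f \<longrightarrow> Q (s + t) f = Q s (Q t f)) \<and>
     (\<forall>t\<ge>0. \<forall>f. C0 X f \<and> (\<forall>x\<in>X. 0 \<le> f x \<and> f x \<le> 1) \<longrightarrow>
         (\<forall>x\<in>X. 0 \<le> Q t f x \<and> Q t f x \<le> 1)) \<and>
     (\<forall>f. C0 X f \<longrightarrow> ((\<lambda>t. supnorm X (\<lambda>x. Q t f x - f x)) \<longlongrightarrow> 0) (at_right 0))"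

definition gen_conv :: "'a set \<Rightarrow> (real \<Rightarrow> ('a \<Rightarrow> real) \<Rightarrow> 'a \<Rightarrow> real) \<Rightarrow>
    ('a \<Rightarrow> real) \<Rightarrow> ('a \<Rightarrow> real) \<Rightarrow> bool" where
  "gen_conv X Q f g \<longleftrightarrow>
     ((\<lambda>t. supnorm X (\<lambda>x. (Q t f x - f x) / t - g x)) \<longlongrightarrow> 0) (at_right 0)"

definition has_generator :: "'a set \<Rightarrow> (real \<Rightarrow> ('a \<Rightarrow> real) \<Rightarrow> 'a \<Rightarrow> real) \<Rightarrow>
    (('a \<Rightarrow> real) \<Rightarrow> 'a \<Rightarrow> real) \<Rightarrow> (('a \<Rightarrow> real) \<Rightarrow> bool) \<Rightarrow> bool" where
  "has_generator X Q G Dom \<longleftrightarrow>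
     (\<forall>f. C0 X f \<longrightarrow>
        (((\<exists>g. C0 X g \<and> gen_conv X Q f g) \<longleftrightarrow> Dom f) \<and>
         (Dom f \<longrightarrow> C0 X (G f) \<and> gen_conv X Q f (G f))))"

definition transport_sg :: "nat \<Rightarrow> (real \<Rightarrow> (int list \<Rightarrow> real) \<Rightarrow> int list \<Rightarrow> real) \<Rightarrow>
    real \<Rightarrow> (int list \<Rightarrow> real) \<Rightarrow> int list \<Rightarrow> real" where
  "transport_sg N Q t f = (\<lambda>\<nu>. if \<nu> \<in> Sig N then
      Q t (\<lambda>n. if n \<in> Omega N then f (n_to_sig N n) else 0) (sig_to_n N \<nu>) else 0)"

definition Dim :: "nat \<Rightarrow> int list \<Rightarrow> real" where
  "Dim N \<nu> = (\<Prod>(i, j) \<in> {(i, j). i < j \<and> j < N}.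
      real_of_int (\<nu> ! i - \<nu> ! j - int i + int j) / (real j - real i))"

text \<open>Unnormalized weight (0-based j corresponds to 1-based i = j+1);
  1/Gamma is rGamma (entire). For admissible parameters it is real.\<close>
definition zw_weight :: "complex \<Rightarrow> complex \<Rightarrow> complex \<Rightarrow> complex \<Rightarrow> nat \<Rightarrow> int list \<Rightarrow> real" where
  "zw_weight z z' w w' N \<nu> =
     Re (\<Prod>j<N. rGamma (z - of_int (\<nu> ! j) + of_nat j + 1) * rGamma (z' - of_int (\<nu> ! j) + of_nat j + 1)
               * rGamma (w + of_nat N + of_int (\<nu> ! j) - of_nat j)
               * rGamma (w' + of_nat N + of_int (\<nu> ! j) - of_nat j))
     * (Dim N \<nu>)\<^sup>2"

definition zw_measure :: "complex \<Rightarrow> complex \<Rightarrow> complex \<Rightarrow> complex \<Rightarrow> nat \<Rightarrow> int list \<Rightarrow> real" where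
  "zw_measure z z' w w' N \<nu> = zw_weight z z' w w' N \<nu> / (\<Sum>\<^sub>\<infinity>\<mu>\<in>Sig N. zw_weight z z' w w' N \<mu>)"

end

theory Submission
  imports Defs
begin

text \<open>
The operator \<open>D\<close> is the generator of a jump process on \<open>\<Omega>\<^sub>N\<close> whose rates satisfy detailed balance with
respect to the zw-weight, since \<open>1/\<Gamma>(u) = u/\<Gamma>(u+1)\<close>. Stationarity amounts to \<open>\<Sum> M Df = 0\<close> for every
\<open>f\<close> in the maximal domain. The point is that such \<open>f\<close> need not be finitely supported. For a finitely
supported cutoff \<open>h\<close>, detailed balance gives \<open>\<Sum> M h Df = \<Sum> M f Dh\<close> and \<open>\<Sum> M Dh = 0\<close>. With
\<open>F(n) = \<Sum> n\<^sub>k\<^sup>2\<close> one has \<open>DF \<le> C (1 + F)\<close>, because the singular cubic terms in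
\<open>\<Sum>\<^sub>k n\<^sub>k\<^sup>3 (\<Prod>\<^sub>j (1 + 1/(n\<^sub>k - n\<^sub>j)) - \<Prod>\<^sub>j (1 - 1/(n\<^sub>k - n\<^sub>j)))\<close> cancel. Hence \<open>h = max(0, 1 - F/R)\<close>
has \<open>Dh\<close> bounded below uniformly in \<open>R\<close> by something tending pointwise to zero; as \<open>\<Sum> M Dh = 0\<close>, this
forces \<open>\<Sum> M |Dh| \<rightarrow> 0\<close>, and so \<open>\<Sum> M Df = 0\<close>.

The argument only needs the weight up to a constant: if that constant vanishes or the weight is not
summable, then \<^const>\<open>zw_measure\<close> is identically zero.
\<close>

section \<open>Partial fractions with unit shifts\<close>

text \<open>As a rational function of \<open>m\<close> the product has simple poles at the distinct
  points \<open>x k\<close> and tends to 1 at infinity, so its residues determine it. The induction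
  uses its hypothesis twice: at \<open>m\<close>, and at the new point \<open>x l\<close>, where it
  evaluates the new residue.\<close>

lemma partial_fraction_prod:
  fixes x :: "'i \<Rightarrow> real"
  assumes "finite I" "inj_on x I" "m \<notin> x ` I"
  shows "(\<Prod>j\<in>I. 1 + c / (m - x j)) =
    1 + c * (\<Sum>k\<in>I. (\<Prod>j\<in>I - {k}. 1 + c / (x k - x j)) / (m - x k))"
  using assms
proof (induction I arbitrary: m rule: finite_induct)
  case empty
  then show ?case by simp
next
  case (insert l I)
  define A where "A k = (\<Prod>j\<in>I - {k}. 1 + c / (x k - x j))" for k
  have xl: "x l \<notin> x ` I" and ml: "m \<noteq> x l" and mI: "m \<notin> x ` I"
    using insert.prems insert.hyps by auto
  have inj: "inj_on x I" using insert.prems by auto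
  have IHm: "(\<Prod>j\<in>I. 1 + c / (m - x j)) = 1 + c * (\<Sum>k\<in>I. A k / (m - x k))"
    unfolding A_def by (rule insert.IH[OF inj mI])
  have IHl: "(\<Prod>j\<in>I. 1 + c / (x l - x j)) = 1 + c * (\<Sum>k\<in>I. A k / (x l - x k))"
    unfolding A_def by (rule insert.IH[OF inj xl])
  have A_insert: "(\<Prod>j\<in>insert l I - {k}. 1 + c / (x k - x j)) = (1 + c / (x k - x l)) * A k"
    if "k \<in> I" for k
  proof -
    have "insert l I - {k} = insert l (I - {k})" using that insert.hyps by auto
    then show ?thesis using insert.hyps by (simp add: A_def)
  qed
  have "c * (\<Sum>k\<in>insert l I. (\<Prod>j\<in>insert l I - {k}. 1 + c / (x k - x j)) / (m - x k)) =
     c * ((1 + c * (\<Sum>k\<in>I. A k / (x l - x k))) / (m - x l) +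
       (\<Sum>k\<in>I. (1 + c / (x k - x l)) * A k / (m - x k)))"
    using insert.hyps A_insert IHl by simp
  also have "\<dots> = c / (m - x l) + c * (\<Sum>k\<in>I. c * (A k / (x l - x k)) / (m - x l) + (1 + c / (x k - x l)) * A k / (m - x k))"
    by (simp add: sum.distrib sum_distrib_left sum_divide_distrib add_divide_distrib algebra_simps)
  also have "(\<Sum>k\<in>I. c * (A k / (x l - x k)) / (m - x l) + (1 + c / (x k - x l)) * A k / (m - x k)) =
     (\<Sum>k\<in>I. (1 + c / (m - x l)) * (A k / (m - x k)))"
  proof (rule sum.cong)
    fix k assume "k \<in> I"
    then have "x k \<noteq> x l" "m \<noteq> x k" using xl mI by (metis imageI)+
    \<comment> \<open>In these differences the claim rests on
      \<open>1 / (u * (u + v)) = (1 / u - 1 / (u + v)) / v\<close>.\<close>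
    define u v where "u = x k - x l" and "v = m - x k"
    have eqs: "m - x l = u + v" "x l - x k = - u" "x k - x l = u" "m - x k = v"
      by (simp_all add: u_def v_def)
    have "u \<noteq> 0" "v \<noteq> 0" "u + v \<noteq> 0"
      using \<open>x k \<noteq> x l\<close> \<open>m \<noteq> x k\<close> ml by (simp_all add: u_def v_def)
    then have "c * (A k / - u) / (u + v) = c * A k * (inverse (u + v) - inverse u) * inverse v"
      by (simp add: divide_simps)
    then show "c * (A k / (x l - x k)) / (m - x l) + (1 + c / (x k - x l)) * A k / (m - x k) =
      (1 + c / (m - x l)) * (A k / (m - x k))"
      unfolding eqs by (simp only: divide_inverse) (simp add: algebra_simps)
  qed simp
  also have "c / (m - x l) + c * \<dots> = (1 + c / (m - x l)) * (1 + c * (\<Sum>k\<in>I. A k / (m - x k))) - 1"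
    unfolding sum_distrib_left[symmetric] by (simp add: field_simps)
  finally show ?case using insert.hyps IHm by simp
qed

text \<open>Up to the factor \<open>c\<close>, these are the coefficients in the expansion of the
  product of the \<open>1 + c / (m - x j)\<close> in powers of \<open>1 / m\<close>. Hence they are
  polynomials in the points, despite the denominators. For \<open>c = 1\<close> and
  \<open>c = - 1\<close> the inner products are Vandermonde ratios under a unit shift.\<close>

definition vsum :: "real \<Rightarrow> ('i \<Rightarrow> real) \<Rightarrow> 'i set \<Rightarrow> nat \<Rightarrow> real" where
  "vsum c x I d = (\<Sum>k\<in>I. (\<Prod>j\<in>I - {k}. 1 + c / (x k - x j)) * x k ^ d)"

text \<open>The new point puts a factor on every old residue and contributes a residue of its own,
  which \<open>partial_fraction_prod\<close> expands. Together they produce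
  \<open>(x l ^ d - x k ^ d) / (x l - x k)\<close>, a polynomial. No denominator is left outside
  \<open>vsum\<close>, so by recursion \<open>vsum\<close> is a polynomial of degree at most
  \<open>d\<close>.\<close>

lemma vsum_insert:
  assumes "finite I" "inj_on x (insert l I)" "l \<notin> I"
  shows "vsum c x (insert l I) d =
    vsum c x I d + x l ^ d + c * (\<Sum>i<d. x l ^ (d - Suc i) * vsum c x I i)"
proof -
  define A where "A k = (\<Prod>j\<in>I - {k}. 1 + c / (x k - x j))" for k
  have xl: "x l \<notin> x ` I" and inj: "inj_on x I" using assms by auto
  have A_insert: "(\<Prod>j\<in>insert l I - {k}. 1 + c / (x k - x j)) = (1 + c / (x k - x l)) * A k"
    if "k \<in> I" for k
  proof -
    have "insert l I - {k} = insert l (I - {k})" using that assms by auto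
    then show ?thesis using assms by (simp add: A_def)
  qed
  have "vsum c x (insert l I) d = (1 + c * (\<Sum>k\<in>I. A k / (x l - x k))) * x l ^ d +
      (\<Sum>k\<in>I. (1 + c / (x k - x l)) * A k * x k ^ d)"
    using assms A_insert partial_fraction_prod[OF assms(1) inj xl, of c]
    by (simp add: vsum_def A_def)
  also have "\<dots> = x l ^ d + (\<Sum>k\<in>I. c * (A k / (x l - x k)) * x l ^ d + (1 + c / (x k - x l)) * A k * x k ^ d)"
    by (simp add: sum.distrib sum_distrib_left sum_distrib_right algebra_simps)
  also have "(\<Sum>k\<in>I. c * (A k / (x l - x k)) * x l ^ d + (1 + c / (x k - x l)) * A k * x k ^ d) =
     (\<Sum>k\<in>I. A k * x k ^ d + c * (\<Sum>i<d. x l ^ (d - Suc i) * (A k * x k ^ i)))"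
  proof (rule sum.cong)
    fix k assume "k \<in> I"
    then have ne: "x l - x k \<noteq> 0" using xl by force
    have "x l ^ d - x k ^ d = (x l - x k) * (\<Sum>i<d. x l ^ (d - Suc i) * x k ^ i)"
      using power_diff_sumr2[of "x k" d "x l"] by (simp add: algebra_simps)
    then have eq: "(\<Sum>i<d. x l ^ (d - Suc i) * x k ^ i) = (x l ^ d - x k ^ d) / (x l - x k)"
      using ne by simp
    have "(\<Sum>i<d. x l ^ (d - Suc i) * (A k * x k ^ i)) = A k * ((x l ^ d - x k ^ d) / (x l - x k))"
      unfolding eq[symmetric] by (simp add: sum_distrib_left algebra_simps)
    moreover have "c / (x k - x l) = - (c / (x l - x k))"
      using ne by (simp add: field_simps)
    ultimately show "c * (A k / (x l - x k)) * x l ^ d + (1 + c / (x k - x l)) * A k * x k ^ d =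
      A k * x k ^ d + c * (\<Sum>i<d. x l ^ (d - Suc i) * (A k * x k ^ i))"
      by (simp only: divide_inverse) (simp add: algebra_simps)
  qed simp
  also have "\<dots> = vsum c x I d + c * (\<Sum>i<d. x l ^ (d - Suc i) * vsum c x I i)"
  proof -
    have "(\<Sum>k\<in>I. \<Sum>i<d. x l ^ (d - Suc i) * (A k * x k ^ i)) =
      (\<Sum>i<d. x l ^ (d - Suc i) * (\<Sum>k\<in>I. A k * x k ^ i))"
      unfolding sum_distrib_left by (rule sum.swap)
    then show ?thesis
      unfolding vsum_def A_def[symmetric] sum.distrib sum_distrib_left[symmetric] by simp
  qed
  finally show ?thesis by simp
qed

text \<open>A polynomial of degree at most \<open>d\<close> is of order \<open>r ^ d\<close>,
  however close together the points are. The induction keeps \<open>d\<close> arbitrary because the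
  recursion calls all lower moments.\<close>

lemma vsum_bound:
  fixes c :: real
  assumes "finite I"
  shows "\<exists>B\<ge>0. \<forall>x r. inj_on x I \<and> 1 \<le> r \<and> (\<forall>k\<in>I. \<bar>x k\<bar> \<le> r) \<longrightarrow> \<bar>vsum c x I d\<bar> \<le> B * r ^ d"
  using assms
proof (induction I arbitrary: d rule: finite_induct)
  case empty
  then show ?case by (intro exI[of _ 0]) (simp add: vsum_def)
next
  case (insert l I)
  obtain B where B0: "\<And>d. B d \<ge> 0"
    and B: "\<And>d x r. inj_on x I \<Longrightarrow> 1 \<le> r \<Longrightarrow> (\<forall>k\<in>I. \<bar>x k\<bar> \<le> r) \<Longrightarrow> \<bar>vsum c x I d\<bar> \<le> B d * r ^ d"
    using insert.IH by metis
  define B' where "B' = B d + 1 + \<bar>c\<bar> * (\<Sum>i<d. B i)"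
  have "\<bar>vsum c x (insert l I) d\<bar> \<le> B' * r ^ d"
    if inj: "inj_on x (insert l I)" and r: "1 \<le> r" and x: "\<forall>k\<in>insert l I. \<bar>x k\<bar> \<le> r" for x and r :: real
  proof -
    have b: "\<bar>vsum c x I d\<bar> \<le> B d * r ^ d" for d using B[of x r d] inj r x by auto
    have pow: "\<bar>x l ^ d\<bar> \<le> r ^ d" for d using x by (simp add: power_abs power_mono)
    have "\<bar>\<Sum>i<d. x l ^ (d - Suc i) * vsum c x I i\<bar> \<le> (\<Sum>i<d. B i * r ^ d)"
    proof (rule sum_abs[THEN order_trans], rule sum_mono)
      fix i assume i: "i \<in> {..<d}"
      have "\<bar>x l ^ (d - Suc i) * vsum c x I i\<bar> \<le> r ^ (d - Suc i) * (B i * r ^ i)"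
        unfolding abs_mult by (intro mult_mono pow b) (use r in auto)
      also have "\<dots> = B i * r ^ (d - 1)"
        using i by (simp flip: power_add)
      \<comment> \<open>The terms carrying \<open>c\<close> have degree only \<open>d - 1\<close>;
        \<open>1 \<le> r\<close> raises them to the common order.\<close>
      also have "\<dots> \<le> B i * r ^ d"
        by (intro mult_left_mono power_increasing) (use r B0 in auto)
      finally show "\<bar>x l ^ (d - Suc i) * vsum c x I i\<bar> \<le> B i * r ^ d" .
    qed
    then have "\<bar>c * (\<Sum>i<d. x l ^ (d - Suc i) * vsum c x I i)\<bar> \<le> \<bar>c\<bar> * (\<Sum>i<d. B i * r ^ d)"
      by (simp add: abs_mult mult_left_mono)
    then have "\<bar>vsum c x (insert l I) d\<bar> \<le> B d * r ^ d + r ^ d + \<bar>c\<bar> * (\<Sum>i<d. B i * r ^ d)"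
      unfolding vsum_insert[OF insert.hyps(1) inj insert.hyps(2)]
      using b[of d] pow[of d] by linarith
    also have "\<dots> = B' * r ^ d" by (simp add: B'_def algebra_simps sum_distrib_left)
    finally show ?thesis .
  qed
  moreover have "B' \<ge> 0" using B0 by (simp add: B'_def sum_nonneg)
  ultimately show ?case by blast
qed

text \<open>The part of degree three is the sum of cubes for either sign of \<open>c\<close>, so it
  drops out of the difference. In the recursion this is the cancellation of \<open>x l ^ 3\<close>;
  what remains has degree two.\<close>

lemma vsum_diff_bound:
  assumes "finite I"
  shows "\<exists>B. \<forall>x r. inj_on x I \<and> 1 \<le> r \<and> (\<forall>k\<in>I. \<bar>x k\<bar> \<le> r) \<longrightarrow>
    \<bar>vsum 1 x I 3 - vsum (- 1) x I 3\<bar> \<le> B * r ^ 2"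
  using assms
proof (induction I rule: finite_induct)
  case empty
  then show ?case by (intro exI[of _ 0]) (simp add: vsum_def)
next
  case (insert l I)
  obtain D where D: "\<And>x r. inj_on x I \<Longrightarrow> 1 \<le> r \<Longrightarrow> (\<forall>k\<in>I. \<bar>x k\<bar> \<le> r) \<Longrightarrow>
      \<bar>vsum 1 x I 3 - vsum (- 1) x I 3\<bar> \<le> D * r ^ 2"
    using insert.IH by metis
  obtain B where B0: "\<And>c d. B c d \<ge> 0"
    and B: "\<And>c d x r. inj_on x I \<Longrightarrow> 1 \<le> r \<Longrightarrow> (\<forall>k\<in>I. \<bar>x k\<bar> \<le> r) \<Longrightarrow> \<bar>vsum c x I d\<bar> \<le> B c d * r ^ d"
    using vsum_bound[OF insert.hyps(1)] by metis
  define B' where "B' = D + (\<Sum>i<3. B 1 i + B (- 1) i)"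
  have "\<bar>vsum 1 x (insert l I) 3 - vsum (- 1) x (insert l I) 3\<bar> \<le> B' * r ^ 2"
    if inj: "inj_on x (insert l I)" and r: "1 \<le> r" and x: "\<forall>k\<in>insert l I. \<bar>x k\<bar> \<le> r" for x and r :: real
  proof -
    have b: "\<bar>vsum c x I d\<bar> \<le> B c d * r ^ d" for c d using B[of x r c d] inj r x by auto
    have "\<bar>\<Sum>i<3. x l ^ (3 - Suc i) * (vsum 1 x I i + vsum (- 1) x I i)\<bar> \<le> (\<Sum>i<3. (B 1 i + B (- 1) i) * r ^ 2)"
    proof (rule sum_abs[THEN order_trans], rule sum_mono)
      fix i assume i: "i \<in> {..<3::nat}"
      have "\<bar>vsum 1 x I i + vsum (- 1) x I i\<bar> \<le> (B 1 i + B (- 1) i) * r ^ i"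
        using b[of 1 i] b[of "- 1" i] by (simp add: algebra_simps)
      then have "\<bar>x l ^ (3 - Suc i) * (vsum 1 x I i + vsum (- 1) x I i)\<bar>
        \<le> r ^ (3 - Suc i) * ((B 1 i + B (- 1) i) * r ^ i)"
        unfolding abs_mult by (intro mult_mono) (use r x in \<open>auto simp: power_abs power_mono\<close>)
      also have "\<dots> = (B 1 i + B (- 1) i) * (r ^ (3 - Suc i) * r ^ i)" by (simp only: ac_simps)
      also have "r ^ (3 - Suc i) * r ^ i = r ^ 2"
        using i by (simp flip: power_add)
      finally show "\<bar>x l ^ (3 - Suc i) * (vsum 1 x I i + vsum (- 1) x I i)\<bar> \<le> (B 1 i + B (- 1) i) * r ^ 2" .
    qed
    moreover have "vsum 1 x (insert l I) 3 - vsum (- 1) x (insert l I) 3 = vsum 1 x I 3 - vsum (- 1) x I 3 +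
      (\<Sum>i<3. x l ^ (3 - Suc i) * (vsum 1 x I i + vsum (- 1) x I i))"
      unfolding vsum_insert[OF insert.hyps(1) inj insert.hyps(2)]
      by (simp add: sum.distrib distrib_left)
    moreover have "\<bar>vsum 1 x I 3 - vsum (- 1) x I 3\<bar> \<le> D * r ^ 2"
      using D[of x r] inj r x by auto
    ultimately have "\<bar>vsum 1 x (insert l I) 3 - vsum (- 1) x (insert l I) 3\<bar> \<le>
       D * r ^ 2 + (\<Sum>i<3. (B 1 i + B (- 1) i) * r ^ 2)" by linarith
    also have "\<dots> = B' * r ^ 2" unfolding B'_def distrib_right sum_distrib_right ..
    finally show ?thesis .
  qed
  then show ?case by blast
qed

text \<open>\<open>2 * x k + 1\<close> and \<open>1 - 2 * x k\<close> are the changes of the square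
  of \<open>x k\<close> under a unit step, and the quadratic factors stand for jump rates with
  leading coefficient one. The third moments therefore enter only through the difference bounded in
  \<open>vsum_diff_bound\<close>.\<close>

lemma vsum_drift_bound:
  fixes p1 p0 s1 s0 :: real
  assumes "finite I"
  shows "\<exists>C\<ge>0. \<forall>x. inj_on x I \<longrightarrow>
    (\<Sum>k\<in>I. (\<Prod>j\<in>I - {k}. 1 + 1 / (x k - x j)) * ((x k)\<^sup>2 + p1 * x k + p0) * (2 * x k + 1) +
        (\<Prod>j\<in>I - {k}. 1 + (- 1) / (x k - x j)) * ((x k)\<^sup>2 + s1 * x k + s0) * (1 - 2 * x k))
    \<le> C * (1 + (\<Sum>k\<in>I. (x k)\<^sup>2))"
proof -
  obtain B where B0: "\<And>c d. B c d \<ge> 0"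
    and B: "\<And>c d x r. inj_on x I \<Longrightarrow> 1 \<le> r \<Longrightarrow> (\<forall>k\<in>I. \<bar>x k\<bar> \<le> r) \<Longrightarrow> \<bar>vsum c x I d\<bar> \<le> B c d * r ^ d"
    using vsum_bound[OF assms] by metis
  obtain D where D: "\<And>x r. inj_on x I \<Longrightarrow> 1 \<le> r \<Longrightarrow> (\<forall>k\<in>I. \<bar>x k\<bar> \<le> r) \<Longrightarrow>
      \<bar>vsum 1 x I 3 - vsum (- 1) x I 3\<bar> \<le> D * r ^ 2"
    using vsum_diff_bound[OF assms] by metis
  \<comment> \<open>The coefficients of \<open>(X^2 + p1 X + p0) (2 X + 1)\<close> and
    \<open>(X^2 + s1 X + s0) (1 - 2 X)\<close> in absolute value, each with the bound for its
    moment.\<close>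
  define C where "C = 2 * \<bar>D\<bar> + \<bar>2 * p1 + 1\<bar> * B 1 2 + \<bar>2 * p0 + p1\<bar> * B 1 1 + \<bar>p0\<bar> * B 1 0
    + \<bar>1 - 2 * s1\<bar> * B (- 1) 2 + \<bar>s1 - 2 * s0\<bar> * B (- 1) 1 + \<bar>s0\<bar> * B (- 1) 0"
  have "(\<Sum>k\<in>I. (\<Prod>j\<in>I - {k}. 1 + 1 / (x k - x j)) * ((x k)\<^sup>2 + p1 * x k + p0) * (2 * x k + 1) +
        (\<Prod>j\<in>I - {k}. 1 + (- 1) / (x k - x j)) * ((x k)\<^sup>2 + s1 * x k + s0) * (1 - 2 * x k))
    \<le> C * (1 + (\<Sum>k\<in>I. (x k)\<^sup>2))" (is "?S \<le> _") if inj: "inj_on x I" for x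
  proof -
    \<comment> \<open>This \<open>r\<close> is at least 1, dominates all the points, and its square
      is the right-hand side of the claim up to \<open>C\<close>.\<close>
    define r where "r = sqrt (1 + (\<Sum>k\<in>I. (x k)\<^sup>2))"
    have nonneg: "0 \<le> (\<Sum>k\<in>I. (x k)\<^sup>2)" by (simp add: sum_nonneg)
    then have r1: "1 \<le> r" and r2: "r\<^sup>2 = 1 + (\<Sum>k\<in>I. (x k)\<^sup>2)" by (simp_all add: r_def)
    have xr: "\<forall>k\<in>I. \<bar>x k\<bar> \<le> r"
    proof
      fix k assume "k \<in> I"
      then have "(x k)\<^sup>2 \<le> (\<Sum>k\<in>I. (x k)\<^sup>2)" using assms by (intro member_le_sum) auto
      then show "\<bar>x k\<bar> \<le> r" unfolding r_def by (intro real_le_rsqrt) simp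
    qed
    have b: "e * vsum c x I d \<le> \<bar>e\<bar> * B c d * r\<^sup>2" if "d \<le> 2" for c d e
    proof -
      have "e * vsum c x I d \<le> \<bar>e\<bar> * \<bar>vsum c x I d\<bar>"
        by (metis abs_ge_self abs_mult)
      also have "\<dots> \<le> \<bar>e\<bar> * (B c d * r ^ d)" using B[OF inj r1 xr] by (intro mult_left_mono) auto
      also have "\<dots> \<le> \<bar>e\<bar> * (B c d * r\<^sup>2)"
        using r1 B0 that by (intro mult_left_mono power_increasing) auto
      finally show ?thesis by simp
    qed
    have "2 * (vsum 1 x I 3 - vsum (- 1) x I 3) \<le> 2 * (D * r\<^sup>2)"
      using order_trans[OF abs_ge_self D[OF inj r1 xr]] by (intro mult_left_mono) auto
    also have "\<dots> \<le> 2 * (\<bar>D\<bar> * r\<^sup>2)" by (simp add: mult_right_mono)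
    finally have d: "2 * (vsum 1 x I 3 - vsum (- 1) x I 3) \<le> 2 * \<bar>D\<bar> * r\<^sup>2" by simp
    have "?S = 2 * (vsum 1 x I 3 - vsum (- 1) x I 3)
       + (2 * p1 + 1) * vsum 1 x I 2 + (2 * p0 + p1) * vsum 1 x I 1 + p0 * vsum 1 x I 0
       + (1 - 2 * s1) * vsum (- 1) x I 2 + (s1 - 2 * s0) * vsum (- 1) x I 1 + s0 * vsum (- 1) x I 0"
      unfolding vsum_def sum_distrib_left sum.distrib[symmetric] sum_subtractf[symmetric]
      by (rule sum.cong) (simp_all add: algebra_simps power2_eq_square power3_eq_cube)
    also have "\<dots> \<le> C * r\<^sup>2"
      unfolding C_def distrib_right[of _ _ "r\<^sup>2"]
      by (intro add_mono d b) simp_all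
    finally show ?thesis unfolding r2 .
  qed
  moreover have "C \<ge> 0" unfolding C_def using B0 by (intro add_nonneg_nonneg mult_nonneg_nonneg) auto
  ultimately show ?thesis by blast
qed

section \<open>Feller semigroups and their generators\<close>

lemma bounded_times_summable:
  fixes w g :: "'a \<Rightarrow> real"
  assumes "w summable_on X" "\<And>x. x \<in> X \<Longrightarrow> \<bar>g x\<bar> \<le> K"
  shows "(\<lambda>x. w x * g x) summable_on X"
proof -
  have "(\<lambda>x. norm (w x)) summable_on X"
    by (rule iffD1[OF summable_on_iff_abs_summable_on_real assms(1)])
  then have "(\<lambda>x. norm (w x) * K) summable_on X" by (rule summable_on_cmult_left)
  then have "(\<lambda>x. norm (w x * g x)) summable_on X"
    by (rule Infinite_Sum.abs_summable_on_comparison_test') (simp add: abs_mult assms(2) mult_left_mono)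
  then show ?thesis by (rule iffD2[OF summable_on_iff_abs_summable_on_real])
qed

lemma abs_infsum_le:
  fixes w g :: "'a \<Rightarrow> real"
  assumes "w summable_on X" "\<And>x. x \<in> X \<Longrightarrow> 0 \<le> w x" "\<And>x. x \<in> X \<Longrightarrow> \<bar>g x\<bar> \<le> K"
  shows "\<bar>\<Sum>\<^sub>\<infinity>x\<in>X. w x * g x\<bar> \<le> infsum w X * K"
proof -
  have summ: "(\<lambda>x. norm (w x * g x)) summable_on X"
    by (rule iffD1[OF summable_on_iff_abs_summable_on_real bounded_times_summable[OF assms(1,3)]])
  moreover have "(\<lambda>x. w x * K) summable_on X" using assms(1) by (rule summable_on_cmult_left)
  ultimately have "(\<Sum>\<^sub>\<infinity>x\<in>X. norm (w x * g x)) \<le> (\<Sum>\<^sub>\<infinity>x\<in>X. w x * K)"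
    by (rule infsum_mono) (simp add: abs_mult assms(2,3) mult_left_mono)
  then have "\<bar>\<Sum>\<^sub>\<infinity>x\<in>X. w x * g x\<bar> \<le> (\<Sum>\<^sub>\<infinity>x\<in>X. w x * K)"
    using norm_infsum_bound[of "\<lambda>x. w x * g x" X] summ by simp
  then show ?thesis by (simp add: infsum_cmult_left')
qed

text \<open>The sums are rewritten as integrals over the counting measure, with dominating function
  \<open>\<bar>w x\<bar> * K\<close>. The limit \<open>g\<close> inherits the bound
  \<open>K\<close>, so its sum can be rewritten as well.\<close>

lemma infsum_dominated_convergence:
  fixes w g :: "'a \<Rightarrow> real" and G :: "nat \<Rightarrow> 'a \<Rightarrow> real"
  assumes w: "w summable_on X"
    and bound: "\<And>n x. x \<in> X \<Longrightarrow> \<bar>G n x\<bar> \<le> K"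
    and lim: "\<And>x. x \<in> X \<Longrightarrow> (\<lambda>n. G n x) \<longlonglongrightarrow> g x"
  shows "(\<lambda>n. \<Sum>\<^sub>\<infinity>x\<in>X. w x * G n x) \<longlonglongrightarrow> (\<Sum>\<^sub>\<infinity>x\<in>X. w x * g x)"
proof -
  have bound_g: "\<bar>g x\<bar> \<le> K" if "x \<in> X" for x
    using tendsto_rabs[OF lim[OF that]] by (rule LIMSEQ_le_const2) (use bound that in blast)
  have integral: "(\<Sum>\<^sub>\<infinity>x\<in>X. w x * h x) = (\<integral>x. w x * h x \<partial>count_space X)"
    if "\<And>x. x \<in> X \<Longrightarrow> \<bar>h x\<bar> \<le> K" for h
  proof -
    have "(\<lambda>x. norm (w x * h x)) summable_on X"
      by (rule iffD1[OF summable_on_iff_abs_summable_on_real bounded_times_summable[OF w that]])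
    then have "Infinite_Set_Sum.abs_summable_on (\<lambda>x. w x * h x) X"
      using abs_summable_equivalent by blast
    then show ?thesis by (simp add: infsetsum_infsum[symmetric] infsetsum_def)
  qed
  have "(\<lambda>n. \<integral>x. w x * G n x \<partial>count_space X) \<longlonglongrightarrow> (\<integral>x. w x * g x \<partial>count_space X)"
  proof (rule integral_dominated_convergence)
    have "(\<lambda>x. norm (w x)) summable_on X"
      by (rule iffD1[OF summable_on_iff_abs_summable_on_real w])
    then have "Infinite_Set_Sum.abs_summable_on w X" using abs_summable_equivalent by blast
    then show "integrable (count_space X) (\<lambda>x. \<bar>w x\<bar> * K)"
      by (simp add: Infinite_Set_Sum.abs_summable_on_def)
    show "AE x in count_space X. (\<lambda>n. w x * G n x) \<longlonglongrightarrow> w x * g x"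
      by (simp add: AE_count_space lim tendsto_mult_left)
    show "AE x in count_space X. norm (w x * G n x) \<le> \<bar>w x\<bar> * K" for n
      by (simp add: AE_count_space abs_mult bound mult_left_mono)
  qed auto
  then show ?thesis using integral[of g] integral[of "G _"] bound bound_g by simp
qed

section \<open>Functions vanishing at infinity and the supremum norm\<close>

lemma C0_bounded:
  assumes "C0 X f"
  obtains K where "0 \<le> K" "\<And>x. \<bar>f x\<bar> \<le> K"
proof -
  define S where "S = {x \<in> X. \<bar>f x\<bar> \<ge> 1}"
  have S: "finite S" using assms by (auto simp: C0_def S_def)
  have "\<bar>f x\<bar> \<le> 1 + (\<Sum>x\<in>S. \<bar>f x\<bar>)" for x
  proof (cases "x \<in> S")
    case True
    then have "\<bar>f x\<bar> \<le> (\<Sum>x\<in>S. \<bar>f x\<bar>)" using S by (intro member_le_sum) auto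
    then show ?thesis by simp
  next
    case False
    then have "\<bar>f x\<bar> \<le> 1" using assms by (cases "x \<in> X") (auto simp: S_def C0_def)
    moreover have "0 \<le> (\<Sum>x\<in>S. \<bar>f x\<bar>)" by (simp add: sum_nonneg)
    ultimately show ?thesis by linarith
  qed
  moreover have "0 \<le> 1 + (\<Sum>x\<in>S. \<bar>f x\<bar>)" by (simp add: sum_nonneg)
  ultimately show ?thesis using that by blast
qed

lemma C0_le:
  assumes "C0 X f" "\<And>x. x \<in> X \<Longrightarrow> \<bar>g x\<bar> \<le> \<bar>f x\<bar>" "\<And>x. x \<notin> X \<Longrightarrow> g x = 0"
  shows "C0 X g"
  unfolding C0_def
proof (intro conjI allI impI)
  fix e :: real assume "e > 0"
  then have "finite {x \<in> X. \<bar>f x\<bar> \<ge> e}" using assms(1) by (simp add: C0_def)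
  then show "finite {x \<in> X. \<bar>g x\<bar> \<ge> e}"
    by (rule finite_subset[rotated]) (use assms(2) in force)
qed (use assms in auto)

lemma C0_finite_support:
  assumes "finite {x. f x \<noteq> 0}" "{x. f x \<noteq> 0} \<subseteq> X"
  shows "C0 X f"
  using assms unfolding C0_def by (auto elim!: finite_subset[rotated])

lemma C0_add:
  assumes "C0 X f" "C0 X g"
  shows "C0 X (\<lambda>x. f x + g x)"
  unfolding C0_def
proof (intro conjI allI impI)
  fix e :: real assume "e > 0"
  then have "finite ({x \<in> X. \<bar>f x\<bar> \<ge> e / 2} \<union> {x \<in> X. \<bar>g x\<bar> \<ge> e / 2})"
    using assms half_gt_zero unfolding C0_def finite_Un by blast
  then show "finite {x \<in> X. \<bar>f x + g x\<bar> \<ge> e}"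
    by (rule finite_subset[rotated]) force
qed (use assms in \<open>auto simp: C0_def\<close>)

lemma C0_cmult:
  assumes "C0 X f"
  shows "C0 X (\<lambda>x. a * f x)"
proof (cases "a = 0")
  case True
  then show ?thesis by (simp add: C0_def)
next
  case False
  have "finite {x \<in> X. \<bar>a * f x\<bar> \<ge> e}" if "e > 0" for e
  proof -
    have "{x \<in> X. \<bar>a * f x\<bar> \<ge> e} = {x \<in> X. \<bar>f x\<bar> \<ge> e / \<bar>a\<bar>}"
      using False by (auto simp: abs_mult field_simps)
    then show ?thesis using assms that False by (auto simp: C0_def)
  qed
  then show ?thesis using assms by (simp add: C0_def)
qed

lemma C0_lincomb: "C0 X f \<Longrightarrow> C0 X g \<Longrightarrow> C0 X (\<lambda>x. a * f x + b * g x)"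
  by (rule C0_add | rule C0_cmult | assumption)+

lemma C0_lincomb3:
  "C0 X f \<Longrightarrow> C0 X g \<Longrightarrow> C0 X h \<Longrightarrow> C0 X (\<lambda>x. a * f x + b * g x + c * h x)"
  by (rule C0_add | rule C0_cmult | assumption)+

lemma abs_le_supnorm:
  assumes "C0 X f" "x \<in> X"
  shows "\<bar>f x\<bar> \<le> supnorm X f"
proof -
  obtain K where "\<And>x. \<bar>f x\<bar> \<le> K" using C0_bounded[OF assms(1)] by blast
  then have "bdd_above ((\<lambda>x. \<bar>f x\<bar>) ` X)" by (intro bdd_aboveI[of _ K]) auto
  then show ?thesis unfolding supnorm_def by (rule cSUP_upper[OF assms(2)])
qed

lemma supnorm_le:
  assumes "X \<noteq> {}" "\<And>x. x \<in> X \<Longrightarrow> \<bar>f x\<bar> \<le> K"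
  shows "supnorm X f \<le> K"
  unfolding supnorm_def using assms by (intro cSUP_least) auto

lemma supnorm_nonneg:
  assumes "C0 X f" "X \<noteq> {}"
  shows "0 \<le> supnorm X f"
proof -
  obtain x where "x \<in> X" using assms(2) by blast
  then show ?thesis using order_trans[OF abs_ge_zero abs_le_supnorm[OF assms(1)]] by blast
qed

section \<open>Consequences of the semigroup axioms\<close>

lemma feller_semigroupD:
  assumes "feller_semigroup X Q"
  shows feller_C0: "0 \<le> t \<Longrightarrow> C0 X f \<Longrightarrow> C0 X (Q t f)"
    and feller_lincomb: "0 \<le> t \<Longrightarrow> C0 X f \<Longrightarrow> C0 X g \<Longrightarrow>
      Q t (\<lambda>x. a * f x + b * g x) = (\<lambda>x. a * Q t f x + b * Q t g x)"
    and feller_0: "C0 X f \<Longrightarrow> Q 0 f = f"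
    and feller_add: "0 \<le> s \<Longrightarrow> 0 \<le> t \<Longrightarrow> C0 X f \<Longrightarrow> Q (s + t) f = Q s (Q t f)"
    and feller_unit_interval: "0 \<le> t \<Longrightarrow> C0 X f \<Longrightarrow> \<forall>x\<in>X. 0 \<le> f x \<and> f x \<le> 1 \<Longrightarrow>
      x \<in> X \<Longrightarrow> 0 \<le> Q t f x \<and> Q t f x \<le> 1"
proof -
  note * = assms[unfolded feller_semigroup_def]
  show "0 \<le> t \<Longrightarrow> C0 X f \<Longrightarrow> C0 X (Q t f)"
    using conjunct1[OF *] by simp
  show "0 \<le> t \<Longrightarrow> C0 X f \<Longrightarrow> C0 X g \<Longrightarrow>
      Q t (\<lambda>x. a * f x + b * g x) = (\<lambda>x. a * Q t f x + b * Q t g x)"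
    using conjunct1[OF conjunct2[OF *]] by simp
  show "C0 X f \<Longrightarrow> Q 0 f = f"
    using conjunct1[OF conjunct2[OF conjunct2[OF *]]] by simp
  show "0 \<le> s \<Longrightarrow> 0 \<le> t \<Longrightarrow> C0 X f \<Longrightarrow> Q (s + t) f = Q s (Q t f)"
    using conjunct1[OF conjunct2[OF conjunct2[OF conjunct2[OF *]]]] by simp
  show "0 \<le> t \<Longrightarrow> C0 X f \<Longrightarrow> \<forall>x\<in>X. 0 \<le> f x \<and> f x \<le> 1 \<Longrightarrow>
      x \<in> X \<Longrightarrow> 0 \<le> Q t f x \<and> Q t f x \<le> 1"
    using conjunct1[OF conjunct2[OF conjunct2[OF conjunct2[OF conjunct2[OF *]]]]] by simp
qed

lemma feller_lincomb3:
  assumes "feller_semigroup X Q" "0 \<le> t" "C0 X f" "C0 X g" "C0 X h"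
  shows "Q t (\<lambda>x. a * f x + b * g x + c * h x) = (\<lambda>x. a * Q t f x + b * Q t g x + c * Q t h x)"
  using feller_lincomb[OF assms(1,2) C0_lincomb[OF assms(3,4)] assms(5), of 1 a b c]
  unfolding feller_lincomb[OF assms(1-4), of a b] mult_1 .

text \<open>Brings the quotient into the shape of a linear combination, to which
  \<open>C0_lincomb3\<close> and \<open>feller_lincomb3\<close> apply.\<close>

lemma difference_quotient_eq:
  fixes u v k h :: real
  shows "(u - v) / h - k = (1 / h) * u + (- 1 / h) * v + (- 1) * k"
  by (simp add: diff_divide_distrib)

lemma C0_difference_quotient:
  assumes "feller_semigroup X Q" "0 < t" "C0 X f" "C0 X g"
  shows "C0 X (\<lambda>x. (Q t f x - f x) / t - g x)"
  unfolding difference_quotient_eq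
  using assms(2) by (intro C0_lincomb3[OF feller_C0[OF assms(1) _ assms(3)] assms(3,4)]) simp

text \<open>The axioms control \<open>Q t\<close> only on functions with values between 0 and 1. So
  \<open>f / K\<close> is split into positive and negative parts; both images lie between 0 and 1,
  and their difference lies between -1 and 1.\<close>

lemma feller_contraction:
  assumes Q: "feller_semigroup X Q" and t: "0 \<le> t" and f: "C0 X f"
    and K: "0 \<le> K" "\<And>x. x \<in> X \<Longrightarrow> \<bar>f x\<bar> \<le> K" and x: "x \<in> X"
  shows "\<bar>Q t f x\<bar> \<le> K"
proof (cases "K = 0")
  \<comment> \<open>Division by \<open>K\<close> is impossible here; but \<open>f\<close> vanishes
    everywhere, and linearity with coefficients 0 gives the value 0.\<close>
  case True
  have "f x = 0" for x using K(2)[of x] f True by (cases "x \<in> X") (auto simp: C0_def)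
  then have "f = (\<lambda>_. 0)" by blast
  then show ?thesis using feller_lincomb[OF Q t f f, of 0 0, THEN fun_cong, of x] True by simp
next
  case False
  define p where "p x = max 0 (f x) / K" for x
  define m where "m x = max 0 (- f x) / K" for x
  have K0: "K > 0" using False K by simp
  have cK: "C0 X (\<lambda>x. (1 / K) * f x)" using f by (rule C0_cmult)
  have "C0 X p"
  proof (rule C0_le[OF cK])
    show "\<bar>p x\<bar> \<le> \<bar>1 / K * f x\<bar>" for x using K0 by (simp add: p_def divide_right_mono)
  qed (use f in \<open>simp add: p_def C0_def\<close>)
  moreover have "C0 X m"
  proof (rule C0_le[OF cK])
    show "\<bar>m x\<bar> \<le> \<bar>1 / K * f x\<bar>" for x using K0 by (simp add: m_def divide_right_mono)
  qed (use f in \<open>simp add: m_def C0_def\<close>)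
  ultimately have C: "C0 X p" "C0 X m" by blast+
  have "f = (\<lambda>x. K * p x + (- K) * m x)" using K0 by (simp add: p_def m_def fun_eq_iff max_def)
  then have eq: "Q t f x = K * (Q t p x - Q t m x)"
    using feller_lincomb[OF Q t C, of K "- K"] by (simp add: algebra_simps)
  note pos = feller_unit_interval[OF Q t _ _ x]
  have "\<forall>x\<in>X. 0 \<le> p x \<and> p x \<le> 1" "\<forall>x\<in>X. 0 \<le> m x \<and> m x \<le> 1"
    using K0 K(2) by (auto simp: p_def m_def abs_le_iff)
  then have "\<bar>Q t p x - Q t m x\<bar> \<le> 1" using pos[OF C(1)] pos[OF C(2)] by auto
  then show ?thesis unfolding eq using K0 by (simp add: abs_mult)
qed

text \<open>Triangle inequality through the difference quotient. It serves below to identify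
  \<open>Q s (G f)\<close> with \<open>G (Q s f)\<close>.\<close>

lemma gen_conv_unique:
  assumes "feller_semigroup X Q" "X \<noteq> {}" "C0 X f" "C0 X g" "C0 X h"
    and "gen_conv X Q f g" "gen_conv X Q f h"
  shows "g = h"
proof
  fix x
  define r where "r t x = (Q t f x - f x) / t" for t x
  have Cr: "C0 X (\<lambda>x. r t x - k x)" if "0 < t" "C0 X k" for t k
    unfolding r_def using C0_difference_quotient[OF assms(1) that(1) assms(3) that(2)] .
  have lim: "((\<lambda>t. supnorm X (\<lambda>x. r t x - g x) + supnorm X (\<lambda>x. r t x - h x)) \<longlongrightarrow> 0 + 0) (at_right 0)"
    using assms(6,7) unfolding gen_conv_def r_def by (rule tendsto_add)
  show "g x = h x"
  proof (cases "x \<in> X")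
    case True
    have "\<forall>\<^sub>F t in at_right (0::real).
      \<bar>g x - h x\<bar> \<le> supnorm X (\<lambda>x. r t x - g x) + supnorm X (\<lambda>x. r t x - h x)"
    proof (rule eventually_at_rightI[of 0 1])
      fix t :: real assume "t \<in> {0<..<1}"
      then have "t > 0" by simp
      show "\<bar>g x - h x\<bar> \<le> supnorm X (\<lambda>x. r t x - g x) + supnorm X (\<lambda>x. r t x - h x)"
        using abs_le_supnorm[OF Cr[OF \<open>t > 0\<close> assms(4)] True] abs_le_supnorm[OF Cr[OF \<open>t > 0\<close> assms(5)] True]
        by linarith
    qed simp
    with lim have "\<bar>g x - h x\<bar> \<le> 0 + 0" by (rule tendsto_lowerbound) simp
    then show ?thesis by simp
  next
    case False
    then show ?thesis using assms(4,5) by (simp add: C0_def)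
  qed
qed

text \<open>For \<open>f\<close> in the domain, the weighted sum of \<open>Q t f\<close> has as
  derivative the weighted sum of \<open>Q t (G f) = G (Q t f)\<close>, which \<open>inv\<close>
  makes zero. By \<open>fin\<close> the finitely supported functions lie in the domain; they are
  uniformly dense, and contractivity extends the result to all of \<open>C0\<close>.\<close>

lemma feller_stationaryI:
  assumes Q: "feller_semigroup X Q"
    and gen: "has_generator X Q G (\<lambda>f. C0 X (G f))"
    and w: "w summable_on X" "\<And>x. x \<in> X \<Longrightarrow> 0 \<le> w x"
    and fin: "\<And>f. finite {x. f x \<noteq> 0} \<Longrightarrow> {x. f x \<noteq> 0} \<subseteq> X \<Longrightarrow> C0 X (G f)"
    and inv: "\<And>f. C0 X f \<Longrightarrow> C0 X (G f) \<Longrightarrow> (\<Sum>\<^sub>\<infinity>x\<in>X. w x * G f x) = 0"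
    and t: "0 \<le> t" and f: "C0 X f"
  shows "(\<Sum>\<^sub>\<infinity>x\<in>X. w x * Q t f x) = (\<Sum>\<^sub>\<infinity>x\<in>X. w x * f x)"
proof (cases "X = {}")
  case False
  define \<mu> where "\<mu> f = (\<Sum>\<^sub>\<infinity>x\<in>X. w x * f x)" for f
  have W: "0 \<le> infsum w X" using w(2) by (rule infsum_nonneg)
  have summ: "(\<lambda>x. w x * g x) summable_on X" if "C0 X g" for g
  proof -
    obtain K where "\<And>x. \<bar>g x\<bar> \<le> K" using C0_bounded[OF \<open>C0 X g\<close>] by blast
    then show ?thesis by (rule bounded_times_summable[OF w(1)])
  qed
  have \<mu>_lincomb: "\<mu> (\<lambda>x. a * g x + b * h x) = a * \<mu> g + b * \<mu> h" if "C0 X g" "C0 X h" for a b g h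
  proof -
    have "\<mu> (\<lambda>x. a * g x + b * h x) = (\<Sum>\<^sub>\<infinity>x\<in>X. a * (w x * g x) + b * (w x * h x))"
      unfolding \<mu>_def by (simp add: algebra_simps)
    also have "\<dots> = (\<Sum>\<^sub>\<infinity>x\<in>X. a * (w x * g x)) + (\<Sum>\<^sub>\<infinity>x\<in>X. b * (w x * h x))"
      by (intro infsum_add summable_on_cmult_right summ that)
    finally show ?thesis by (simp add: \<mu>_def infsum_cmult_right')
  qed
  have \<mu>_bound: "\<bar>\<mu> g\<bar> \<le> infsum w X * K" if "\<And>x. x \<in> X \<Longrightarrow> \<bar>g x\<bar> \<le> K" for g K
    unfolding \<mu>_def by (rule abs_infsum_le[OF w that])
  \<comment> \<open>The vanishing derivative is integrated by hand: \<open>[0, t]\<close> is cut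
    into equal steps of length \<open>h\<close>, whose errors add up to at most
    \<open>t * infsum w X * E h\<close>.\<close>
  have core: "\<mu> (Q t f) = \<mu> f" if t: "0 < t" and f: "C0 X f" and Gf: "C0 X (G f)" for t f
  proof -
    define E where "E h = supnorm X (\<lambda>x. (Q h f x - f x) / h - G f x)" for h
    have gconv: "gen_conv X Q f (G f)" using gen f Gf by (auto simp: has_generator_def)
    have CE: "C0 X (\<lambda>x. (Q h f x - f x) / h - G f x)" if "h > 0" for h
      using C0_difference_quotient[OF Q that f Gf] .
    have E0: "0 \<le> E h" if "h > 0" for h
      unfolding E_def using supnorm_nonneg[OF CE[OF that] False] .
    \<comment> \<open>Since \<open>Q s\<close> commutes with \<open>Q h\<close> and is a
      contraction, the error \<open>E h\<close> at time 0 controls the difference quotient at every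
      time \<open>s\<close>.\<close>
    have diff: "\<bar>(Q h (Q s f) x - Q s f x) / h - Q s (G f) x\<bar> \<le> E h"
      if h: "h > 0" and s: "s \<ge> 0" and x: "x \<in> X" for h s x
    proof -
      have "Q h (Q s f) = Q s (Q h f)"
        using feller_add[OF Q _ _ f, of h s] feller_add[OF Q _ _ f, of s h] h s by (simp add: add.commute)
      moreover have "Q s (\<lambda>x. (Q h f x - f x) / h - G f x) =
        (\<lambda>x. (Q s (Q h f) x - Q s f x) / h - Q s (G f) x)"
        unfolding difference_quotient_eq
        by (rule feller_lincomb3[OF Q s feller_C0[OF Q less_imp_le[OF h] f] f Gf])
      ultimately have "(Q h (Q s f) x - Q s f x) / h - Q s (G f) x = Q s (\<lambda>x. (Q h f x - f x) / h - G f x) x"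
        by simp
      then show ?thesis
        using feller_contraction[OF Q s CE[OF h] E0[OF h] _ x] abs_le_supnorm[OF CE[OF h]]
        by (simp add: E_def)
    qed
    \<comment> \<open>The difference quotients of \<open>Q s f\<close> converge to
      \<open>Q s (G f)\<close>, which puts \<open>Q s f\<close> into the domain. Uniqueness of the
      limit then gives \<open>Q s (G f) = G (Q s f)\<close>, and \<open>inv\<close> applies.\<close>
    have zero: "\<mu> (Q s (G f)) = 0" if s: "s \<ge> 0" for s
    proof -
      have C: "C0 X (Q s f)" "C0 X (Q s (G f))" using feller_C0[OF Q s] f Gf by auto
      have "gen_conv X Q (Q s f) (Q s (G f))"
        unfolding gen_conv_def
      proof (rule tendsto_sandwich[of "\<lambda>_. 0" _ _ E])
        have "C0 X (\<lambda>x. (Q h (Q s f) x - Q s f x) / h - Q s (G f) x)" if "h > 0" for h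
          using C0_difference_quotient[OF Q that C] .
        then show "\<forall>\<^sub>F h in at_right 0. 0 \<le> supnorm X (\<lambda>x. (Q h (Q s f) x - Q s f x) / h - Q s (G f) x)"
          by (intro eventually_at_rightI[of 0 1] supnorm_nonneg False) auto
        have "supnorm X (\<lambda>x. (Q h (Q s f) x - Q s f x) / h - Q s (G f) x) \<le> E h" if "h > 0" for h
          by (rule supnorm_le[OF False diff[OF that s]])
        then show "\<forall>\<^sub>F h in at_right 0. supnorm X (\<lambda>x. (Q h (Q s f) x - Q s f x) / h - Q s (G f) x) \<le> E h"
          by (intro eventually_at_rightI[of 0 1]) auto
        show "(E \<longlongrightarrow> 0) (at_right 0)" using gconv by (simp add: gen_conv_def E_def[abs_def])
      qed simp
      then have "C0 X (G (Q s f))" and "gen_conv X Q (Q s f) (G (Q s f))"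
        using gen C by (auto simp: has_generator_def)
      then have "Q s (G f) = G (Q s f)"
        using gen_conv_unique[OF Q False C(1,2)] \<open>gen_conv X Q (Q s f) (Q s (G f))\<close> by blast
      then show ?thesis using inv[OF C(1)] \<open>C0 X (G (Q s f))\<close> by (simp add: \<mu>_def)
    qed
    have step: "\<bar>\<mu> (Q (s + h) f) - \<mu> (Q s f)\<bar> \<le> h * (infsum w X * E h)" if h: "h > 0" and s: "s \<ge> 0" for h s
    proof -
      have C: "C0 X (Q h (Q s f))" "C0 X (Q s f)" "C0 X (Q s (G f))"
        using feller_C0[OF Q s f] feller_C0[OF Q s Gf] feller_C0[OF Q, of h "Q s f"] h by simp_all
      have "\<mu> (\<lambda>x. (Q h (Q s f) x - Q s f x) / h - Q s (G f) x) =
        \<mu> (\<lambda>x. 1 * ((1 / h) * Q h (Q s f) x + (- 1 / h) * Q s f x) + (- 1) * Q s (G f) x)"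
        unfolding difference_quotient_eq by simp
      also have "\<dots> = (\<mu> (Q h (Q s f)) - \<mu> (Q s f)) / h"
        using \<mu>_lincomb[OF C0_lincomb[OF C(1,2)] C(3), of 1 "1 / h" "- 1 / h" "- 1"]
          \<mu>_lincomb[OF C(1,2), of "1 / h" "- 1 / h"] zero[OF s] by (simp add: diff_divide_distrib)
      finally have "\<bar>(\<mu> (Q h (Q s f)) - \<mu> (Q s f)) / h\<bar> \<le> infsum w X * E h"
        using \<mu>_bound[of "\<lambda>x. (Q h (Q s f) x - Q s f x) / h - Q s (G f) x" "E h"] diff[OF h s] by simp
      moreover have "Q (s + h) f = Q h (Q s f)" using feller_add[OF Q _ _ f, of h s] h s by (simp add: add.commute)
      ultimately show ?thesis using h by (simp add: field_simps)
    qed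
    have steps: "\<bar>\<mu> (Q (real n * h) f) - \<mu> (Q 0 f)\<bar> \<le> real n * (h * (infsum w X * E h))" if h: "h > 0" for n h
    proof (induction n)
      case (Suc n)
      have "real (Suc n) * h = real n * h + h" by (simp add: algebra_simps)
      then show ?case
        using Suc step[OF h, of "real n * h"] h by (simp add: algebra_simps)
    qed simp
    have "\<bar>\<mu> (Q t f) - \<mu> (Q 0 f)\<bar> \<le> t * infsum w X * E (t / real (Suc n))" for n
      using steps[of "t / real (Suc n)" "Suc n"] t by (simp add: mult.assoc)
    moreover have "(\<lambda>n. t * infsum w X * E (t / real (Suc n))) \<longlonglongrightarrow> t * infsum w X * 0"
    proof (intro tendsto_mult_left)
      have "filterlim (\<lambda>n. t / real (Suc n)) (at_right 0) sequentially"
        using t LIMSEQ_Suc[OF lim_const_over_n[of t]]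
        by (intro tendsto_imp_filterlim_at_right) (auto simp: divide_pos_pos)
      moreover have "(E \<longlongrightarrow> 0) (at_right 0)" using gconv by (simp add: gen_conv_def E_def[abs_def])
      ultimately show "(\<lambda>n. E (t / real (Suc n))) \<longlonglongrightarrow> 0" by (rule filterlim_compose[rotated])
    qed
    ultimately have "\<bar>\<mu> (Q t f) - \<mu> (Q 0 f)\<bar> \<le> t * infsum w X * 0"
      by (intro LIMSEQ_le_const[of _ _ "\<bar>\<mu> (Q t f) - \<mu> (Q 0 f)\<bar>"]) auto
    moreover have "Q 0 f = f" using feller_0[OF Q f] by simp
    ultimately show ?thesis by simp
  qed
  show ?thesis
  proof (cases "t = 0")
    case True
    then show ?thesis using feller_0[OF Q f] by simp
  next
    case False
    then have t: "t > 0" using t by simp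
    have "\<bar>\<mu> (Q t f) - \<mu> f\<bar> \<le> 0 + e" if e: "e > 0" for e
    proof -
      \<comment> \<open>Replacing \<open>f\<close> by its truncation \<open>g\<close> costs at most
        \<open>infsum w X * d\<close> before and after applying \<open>Q t\<close>, together less
        than \<open>e\<close>. The \<open>+ 1\<close> keeps the denominator positive when the total
        mass is 0.\<close>
      define d where "d = e / (2 * (infsum w X + 1))"
      have d: "d > 0" using e W by (simp add: d_def)
      define S where "S = {x \<in> X. \<bar>f x\<bar> \<ge> d}"
      define g where "g x = (if x \<in> S then f x else 0)" for x
      have S: "finite S" using f d by (auto simp: C0_def S_def)
      have "{x. g x \<noteq> 0} \<subseteq> S" by (auto simp: g_def split: if_splits)
      then have supp: "finite {x. g x \<noteq> 0}" "{x. g x \<noteq> 0} \<subseteq> X"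
        using finite_subset[OF _ S] by (auto simp: S_def)
      have g: "C0 X g" using supp by (rule C0_finite_support)
      have diff: "\<bar>1 * f x + (- 1) * g x\<bar> \<le> d" if "x \<in> X" for x
        using that d by (auto simp: g_def S_def)
      have C: "C0 X (\<lambda>x. 1 * f x + (- 1) * g x)" using f g by (rule C0_lincomb)
      have "\<bar>Q t (\<lambda>x. 1 * f x + (- 1) * g x) x\<bar> \<le> d" if "x \<in> X" for x
        by (rule feller_contraction[OF Q less_imp_le[OF t] C less_imp_le[OF d] diff that])
      then have "\<bar>\<mu> (Q t (\<lambda>x. 1 * f x + (- 1) * g x))\<bar> \<le> infsum w X * d" by (rule \<mu>_bound)
      then have 1: "\<bar>\<mu> (Q t f) - \<mu> (Q t g)\<bar> \<le> infsum w X * d"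
        unfolding feller_lincomb[OF Q less_imp_le[OF t] f g]
          \<mu>_lincomb[OF feller_C0[OF Q less_imp_le[OF t] f] feller_C0[OF Q less_imp_le[OF t] g]]
        by simp
      have "\<bar>\<mu> (\<lambda>x. 1 * f x + (- 1) * g x)\<bar> \<le> infsum w X * d" using diff by (rule \<mu>_bound)
      then have 2: "\<bar>\<mu> f - \<mu> g\<bar> \<le> infsum w X * d" unfolding \<mu>_lincomb[OF f g] by simp
      have "\<mu> (Q t g) = \<mu> g" using core[OF t g fin[OF supp]] .
      then have "\<bar>\<mu> (Q t f) - \<mu> f\<bar> \<le> 2 * (infsum w X * d)" using 1 2 by linarith
      also have "\<dots> = e * (infsum w X / (infsum w X + 1))" using W by (simp add: d_def field_simps)
      also have "\<dots> \<le> e * 1"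
      proof (rule mult_left_mono)
        show "infsum w X / (infsum w X + 1) \<le> 1" using W by simp
      qed (use e in simp)
      finally show ?thesis by simp
    qed
    then have "\<bar>\<mu> (Q t f) - \<mu> f\<bar> \<le> 0" by (rule field_le_epsilon)
    then show ?thesis by (simp add: \<mu>_def)
  qed
qed simp

section \<open>Reversible chains with a Lyapunov function\<close>

text \<open>\<open>F_proper\<close> makes the cutoffs built from \<open>F\<close> finitely
  supported. \<open>drift\<close> is the Foster-Lyapunov growth condition; it bounds the generator
  on these cutoffs from below.\<close>

locale reversible_chain =
  fixes X :: "'a set" and q :: "'a \<Rightarrow> 'a \<Rightarrow> real" and w :: "'a \<Rightarrow> real" and F :: "'a \<Rightarrow> real" and C :: real
  assumes q_nonneg: "\<And>x y. x \<in> X \<Longrightarrow> y \<in> X \<Longrightarrow> 0 \<le> q x y"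
    and finite_nbrs: "\<And>x. x \<in> X \<Longrightarrow> finite {y \<in> X. q x y \<noteq> 0}"
    and balance: "\<And>x y. x \<in> X \<Longrightarrow> y \<in> X \<Longrightarrow> w x * q x y = w y * q y x"
    and w_pos: "\<And>x. x \<in> X \<Longrightarrow> 0 < w x"
    and w_summable: "w summable_on X"
    and F_nonneg: "\<And>x. x \<in> X \<Longrightarrow> 0 \<le> F x"
    and F_proper: "\<And>R. finite {x \<in> X. F x < R}"
    and C_nonneg: "0 \<le> C"
    and drift: "\<And>x. x \<in> X \<Longrightarrow> (\<Sum>y | y \<in> X \<and> q x y \<noteq> 0. q x y * (F y - F x)) \<le> C * (1 + F x)"
begin

definition nbrs :: "'a \<Rightarrow> 'a set" where
  "nbrs x = {y \<in> X. q x y \<noteq> 0}"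

definition L :: "('a \<Rightarrow> real) \<Rightarrow> 'a \<Rightarrow> real" where
  "L f x = (\<Sum>y\<in>nbrs x. q x y * (f y - f x))"

text \<open>By detailed balance with a positive weight, a jump and its reversal are possible or
  impossible together.\<close>

lemma nbrs_sym: "x \<in> X \<Longrightarrow> y \<in> nbrs x \<Longrightarrow> x \<in> nbrs y"
proof -
  assume *: "x \<in> X" "y \<in> nbrs x"
  then have y: "y \<in> X" "q x y \<noteq> 0" by (simp_all add: nbrs_def)
  then have "w x * q x y \<noteq> 0" using w_pos[OF *(1)] by simp
  then have "q y x \<noteq> 0" unfolding balance[OF *(1) y(1)] by simp
  then show "x \<in> nbrs y" using * by (simp add: nbrs_def)
qed

text \<open>Lets the sum over neighbours run over one fixed finite set for all \<open>x\<close>, as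
  the exchange of summations in \<open>green\<close> requires.\<close>

lemma L_eq:
  assumes "x \<in> X" "finite B" "B \<subseteq> X" "\<And>y. y \<in> nbrs x - B \<Longrightarrow> f y = f x"
  shows "L f x = (\<Sum>y\<in>B. q x y * (f y - f x))"
proof -
  have fin: "finite (nbrs x)" using finite_nbrs[OF assms(1)] by (simp add: nbrs_def)
  have "(\<Sum>y\<in>nbrs x. q x y * (f y - f x)) = (\<Sum>y\<in>nbrs x \<union> B. q x y * (f y - f x))"
    by (rule sum.mono_neutral_left) (use fin assms in \<open>auto simp: nbrs_def\<close>)
  also have "\<dots> = (\<Sum>y\<in>B. q x y * (f y - f x))"
    by (rule sum.mono_neutral_right) (use fin assms in auto)
  finally show ?thesis by (simp add: L_def)
qed

text \<open>Jumps are local, so \<open>L\<close> preserves finite support; this is how finitely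
  supported functions enter the domain of the generator.\<close>

lemma L_finite_support:
  assumes "finite S" "S \<subseteq> X" "\<And>x. x \<in> X - S \<Longrightarrow> f x = 0" "x \<in> X - (S \<union> (\<Union>s\<in>S. nbrs s))"
  shows "L f x = 0"
proof -
  have "f y = f x" if "y \<in> nbrs x" for y
  proof -
    have "y \<in> X" using that by (simp add: nbrs_def)
    moreover have "y \<notin> S" using nbrs_sym[of x y] that assms(4) by blast
    ultimately show ?thesis using assms(3)[of y] assms(3)[of x] assms(4) by simp
  qed
  then show ?thesis by (simp add: L_def)
qed

text \<open>Summation by parts from the symmetry of \<open>w x * q x y\<close>. Only
  \<open>h\<close> has finite support, so \<open>f\<close> may be arbitrary; \<open>B\<close>
  contains every point that a jump from \<open>S\<close> can reach, and both sums become finite sums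
  over pairs from \<open>B\<close>.\<close>

lemma green:
  assumes S: "finite S" "S \<subseteq> X" and B: "B = S \<union> (\<Union>s\<in>S. nbrs s)"
    and supp: "\<And>x. x \<in> X - S \<Longrightarrow> h x = 0"
  shows "(\<Sum>x\<in>B. w x * (f x * L h x)) = (\<Sum>x\<in>S. w x * (h x * L f x))"
proof -
  have BX: "B \<subseteq> X" using S by (auto simp: B nbrs_def)
  have finB: "finite B" using S finite_nbrs by (auto simp: B nbrs_def)
  have Lh: "L h x = (\<Sum>y\<in>B. q x y * (h y - h x))" if "x \<in> B" for x
  proof (rule L_eq)
    fix y assume y: "y \<in> nbrs x - B"
    then have "x \<notin> S" by (auto simp: B)
    moreover have "y \<in> X" "y \<notin> S" using y by (auto simp: B nbrs_def)
    ultimately show "h y = h x" using supp[of x] supp[of y] that BX by auto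
  qed (use that BX finB in auto)
  have Lf: "L f x = (\<Sum>y\<in>B. q x y * (f y - f x))" if "x \<in> S" for x
    by (rule L_eq) (use that BX finB S in \<open>auto simp: B\<close>)
  have "(\<Sum>x\<in>S. w x * (h x * L f x)) = (\<Sum>x\<in>S. \<Sum>y\<in>B. w x * q x y * (h x * (f y - f x)))"
    using Lf by (simp add: sum_distrib_left algebra_simps)
  also have "\<dots> = (\<Sum>x\<in>B. \<Sum>y\<in>B. w x * q x y * (h x * (f y - f x)))"
  proof (rule sum.mono_neutral_left[OF finB])
    show "\<forall>x\<in>B - S. (\<Sum>y\<in>B. w x * q x y * (h x * (f y - f x))) = 0"
      using supp BX by (auto intro!: sum.neutral)
  qed (simp add: B)
  finally have 1: "(\<Sum>x\<in>S. w x * (h x * L f x)) = (\<Sum>x\<in>B. \<Sum>y\<in>B. w x * q x y * (h x * (f y - f x)))" .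
  have "(\<Sum>x\<in>B. w x * (f x * L h x)) = (\<Sum>x\<in>B. \<Sum>y\<in>B. w x * q x y * (f x * (h y - h x)))"
    using Lh by (simp add: sum_distrib_left algebra_simps)
  also have "\<dots> = (\<Sum>x\<in>B. \<Sum>y\<in>B. w x * q x y * (f x * h y)) - (\<Sum>x\<in>B. \<Sum>y\<in>B. w x * q x y * (f x * h x))"
    by (simp add: sum_subtractf[symmetric] algebra_simps)
  \<comment> \<open>Exchanging the roles of \<open>x\<close> and \<open>y\<close> turns the cross
    term \<open>f x * h y\<close> into \<open>h x * f y\<close>; the diagonal term is common to both
    sides.\<close>
  also have "(\<Sum>x\<in>B. \<Sum>y\<in>B. w x * q x y * (f x * h y)) = (\<Sum>y\<in>B. \<Sum>x\<in>B. w x * q x y * (f x * h y))"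
    by (rule sum.swap)
  also have "\<dots> = (\<Sum>y\<in>B. \<Sum>x\<in>B. w y * q y x * (h y * f x))"
  proof (intro sum.cong refl)
    fix x y assume "y \<in> B" "x \<in> B"
    then have "w x * q x y = w y * q y x" using BX by (intro balance) auto
    then show "w x * q x y * (f x * h y) = w y * q y x * (h y * f x)" by simp
  qed
  also have "\<dots> - (\<Sum>x\<in>B. \<Sum>y\<in>B. w x * q x y * (f x * h x)) = (\<Sum>x\<in>B. \<Sum>y\<in>B. w x * q x y * (h x * (f y - f x)))"
    by (simp add: sum_subtractf[symmetric] algebra_simps)
  finally show ?thesis using 1 by simp
qed

section \<open>Cutoffs along the Lyapunov function\<close>

definition cutoff :: "nat \<Rightarrow> 'a \<Rightarrow> real" where
  "cutoff n x = max 0 (1 - F x / real (Suc n))"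

definition sublevel :: "nat \<Rightarrow> 'a set" where
  "sublevel n = {x \<in> X. F x < real (Suc n)}"

definition nbhd :: "nat \<Rightarrow> 'a set" where
  "nbhd n = sublevel n \<union> (\<Union>s\<in>sublevel n. nbrs s)"

text \<open>A bound for the negative part of \<open>L (cutoff n)\<close>: where the cutoff is
  positive it comes from \<open>drift\<close> divided by \<open>Suc n\<close>.\<close>

definition defect :: "nat \<Rightarrow> 'a \<Rightarrow> real" where
  "defect n x = (if x \<in> sublevel n then C * (1 + F x) / real (Suc n) else 0)"

lemma sublevel: "finite (sublevel n)" "sublevel n \<subseteq> X"
  using F_proper by (auto simp: sublevel_def)

lemma nbhd: "finite (nbhd n)" "nbhd n \<subseteq> X"
  using sublevel[of n] finite_nbrs by (auto simp: nbhd_def nbrs_def)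

lemma cutoff_bounds:
  assumes "x \<in> X"
  shows "0 \<le> cutoff n x" "cutoff n x \<le> 1"
  using F_nonneg[OF assms] by (auto simp: cutoff_def)

lemma cutoff_outside: "x \<in> X - sublevel n \<Longrightarrow> cutoff n x = 0"
  by (auto simp: cutoff_def sublevel_def field_simps)

lemma cutoff_tendsto: "(\<lambda>n. cutoff n x) \<longlonglongrightarrow> 1"
proof -
  have "(\<lambda>n. max 0 (1 - F x / real (Suc n))) \<longlonglongrightarrow> max 0 (1 - 0)"
    by (intro tendsto_intros LIMSEQ_Suc[OF lim_const_over_n])
  then show ?thesis by (simp add: cutoff_def)
qed

text \<open>On the sublevel set \<open>1 + F x\<close> is at most twice \<open>Suc n\<close>, so the
  bound is uniform in \<open>n\<close>, as dominated convergence needs.\<close>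

lemma defect_bounds:
  assumes "x \<in> X"
  shows "0 \<le> defect n x" "\<bar>defect n x\<bar> \<le> 2 * C"
proof -
  show nonneg: "0 \<le> defect n x" using F_nonneg[OF assms] C_nonneg by (simp add: defect_def)
  have "C * (1 + F x) \<le> C * (2 * real (Suc n))" if "F x < real (Suc n)"
    using that C_nonneg by (intro mult_left_mono) auto
  then have "defect n x \<le> 2 * C"
    using C_nonneg by (auto simp: defect_def sublevel_def divide_le_eq algebra_simps)
  then show "\<bar>defect n x\<bar> \<le> 2 * C" using nonneg by simp
qed

lemma defect_tendsto: "(\<lambda>n. defect n x) \<longlonglongrightarrow> 0"
proof (rule Lim_null_comparison)
  show "\<forall>\<^sub>F n in sequentially. norm (defect n x) \<le> \<bar>C * (1 + F x)\<bar> / real (Suc n)"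
    by (intro always_eventually) (simp add: defect_def abs_mult)
  show "(\<lambda>n. \<bar>C * (1 + F x)\<bar> / real (Suc n)) \<longlonglongrightarrow> 0"
    by (rule LIMSEQ_Suc[OF lim_const_over_n])
qed

text \<open>The cutoff is nowhere below \<open>1 - F / Suc n\<close> and equals it on the sublevel
  set, where \<open>drift\<close> gives the estimate. Off that set it attains its minimum 0, so
  every jump can only increase it.\<close>

lemma L_cutoff_ge:
  assumes x: "x \<in> X"
  shows "- defect n x \<le> L (cutoff n) x"
proof (cases "x \<in> sublevel n")
  case True
  then have cx: "cutoff n x = 1 - F x / real (Suc n)" by (auto simp: cutoff_def sublevel_def)
  have "- (C * (1 + F x)) / real (Suc n) \<le> - L F x / real (Suc n)"
    using drift[OF x] by (intro divide_right_mono) (auto simp: L_def nbrs_def)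
  also have "\<dots> = (\<Sum>y\<in>nbrs x. q x y * ((1 - F y / real (Suc n)) - cutoff n x))"
    unfolding cx L_def sum_negf[symmetric] sum_divide_distrib
    by (intro sum.cong refl) (simp add: algebra_simps diff_divide_distrib)
  also have "\<dots> \<le> L (cutoff n) x"
    unfolding L_def by (intro sum_mono mult_left_mono) (auto simp: cutoff_def nbrs_def q_nonneg x)
  finally show ?thesis using True by (simp add: defect_def)
next
  case False
  have "0 \<le> L (cutoff n) x"
    unfolding L_def using cutoff_outside[of x n] False x
    by (intro sum_nonneg mult_nonneg_nonneg) (auto simp: nbrs_def q_nonneg cutoff_bounds)
  then show ?thesis using False by (simp add: defect_def)
qed

text \<open>If \<open>- b \<le> a\<close> and \<open>0 \<le> b\<close>, then
  \<open>\<bar>a\<bar> \<le> a + 2 * b\<close>. With \<open>a\<close> the value of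
  \<open>L (cutoff n)\<close> and \<open>b\<close> the defect, the weighted sum of \<open>a\<close>
  is zero, by \<open>green\<close> against the constant 1.\<close>

lemma sum_abs_L_cutoff_le:
  "(\<Sum>x\<in>nbhd n. w x * \<bar>L (cutoff n) x\<bar>) \<le> 2 * (\<Sum>\<^sub>\<infinity>x\<in>X. w x * defect n x)"
proof -
  have "(\<Sum>x\<in>nbhd n. w x * (1 * L (cutoff n) x)) = (\<Sum>x\<in>sublevel n. w x * (cutoff n x * L (\<lambda>_. 1) x))"
    by (rule green[OF sublevel nbhd_def cutoff_outside])
  then have zero: "(\<Sum>x\<in>nbhd n. w x * L (cutoff n) x) = 0" by (simp add: L_def)
  have "(\<Sum>x\<in>nbhd n. w x * \<bar>L (cutoff n) x\<bar>) \<le>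
    (\<Sum>x\<in>nbhd n. w x * L (cutoff n) x + 2 * (w x * defect n x))"
  proof (rule sum_mono)
    fix x assume "x \<in> nbhd n"
    then have x: "x \<in> X" using nbhd by blast
    have "\<bar>L (cutoff n) x\<bar> \<le> L (cutoff n) x + 2 * defect n x"
      using L_cutoff_ge[OF x, of n] defect_bounds[OF x, of n] by linarith
    then have "w x * \<bar>L (cutoff n) x\<bar> \<le> w x * (L (cutoff n) x + 2 * defect n x)"
      using w_pos[OF x] by (intro mult_left_mono) auto
    then show "w x * \<bar>L (cutoff n) x\<bar> \<le> w x * L (cutoff n) x + 2 * (w x * defect n x)"
      by (simp add: algebra_simps)
  qed
  also have "\<dots> = 2 * (\<Sum>x\<in>nbhd n. w x * defect n x)"
    by (simp add: sum.distrib zero sum_distrib_left)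
  also have "(\<Sum>x\<in>nbhd n. w x * defect n x) = (\<Sum>\<^sub>\<infinity>x\<in>nbhd n. w x * defect n x)"
    using nbhd by simp
  also have "\<dots> \<le> (\<Sum>\<^sub>\<infinity>x\<in>X. w x * defect n x)"
  proof (rule infsum_mono2)
    show "(\<lambda>x. w x * defect n x) summable_on X"
      by (rule bounded_times_summable[OF w_summable defect_bounds(2)])
    show "0 \<le> w x * defect n x" if "x \<in> X - nbhd n" for x
      using that w_pos[of x] defect_bounds(1)[of x n] by simp
  qed (use nbhd in auto)
  finally show ?thesis by simp
qed

text \<open>The sum of \<^term>\<open>w x * L (cutoff n) x\<close> vanishes and its negative part tends to zero by
  dominated convergence, hence so does its absolute value.\<close>

lemma infsum_L_eq_0:
  assumes f: "\<And>x. x \<in> X \<Longrightarrow> \<bar>f x\<bar> \<le> K" and Lf: "\<And>x. x \<in> X \<Longrightarrow> \<bar>L f x\<bar> \<le> K'"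
  shows "(\<Sum>\<^sub>\<infinity>x\<in>X. w x * L f x) = 0"
proof -
  \<comment> \<open>The limit of \<open>a\<close> is computed twice: directly by dominated
    convergence, and after \<open>green\<close> has moved \<open>L\<close> from \<open>f\<close> to
    the cutoff.\<close>
  define a where "a n = (\<Sum>\<^sub>\<infinity>x\<in>X. w x * (cutoff n x * L f x))" for n
  have "a \<longlonglongrightarrow> (\<Sum>\<^sub>\<infinity>x\<in>X. w x * (1 * L f x))"
    unfolding a_def
  proof (rule infsum_dominated_convergence[OF w_summable])
    show "\<bar>cutoff n x * L f x\<bar> \<le> 1 * K'" if "x \<in> X" for n x
      unfolding abs_mult using cutoff_bounds[OF that, of n] Lf[OF that]
      by (intro mult_mono) auto
    show "(\<lambda>n. cutoff n x * L f x) \<longlonglongrightarrow> 1 * L f x" if "x \<in> X" for x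
      by (intro tendsto_mult cutoff_tendsto tendsto_const)
  qed
  moreover have "a \<longlonglongrightarrow> 0"
  proof (rule Lim_null_comparison)
    show "\<forall>\<^sub>F n in sequentially. norm (a n) \<le> \<bar>K\<bar> * (2 * (\<Sum>\<^sub>\<infinity>x\<in>X. w x * defect n x))"
    proof (intro always_eventually allI)
      fix n
      have "a n = (\<Sum>\<^sub>\<infinity>x\<in>sublevel n. w x * (cutoff n x * L f x))"
        unfolding a_def by (rule infsum_cong_neutral) (use sublevel[of n] cutoff_outside[of _ n] in auto)
      also have "\<dots> = (\<Sum>x\<in>sublevel n. w x * (cutoff n x * L f x))"
        using sublevel by simp
      also have "\<dots> = (\<Sum>x\<in>nbhd n. w x * (f x * L (cutoff n) x))"
        by (rule green[OF sublevel nbhd_def cutoff_outside, symmetric])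
      finally have "norm (a n) \<le> (\<Sum>x\<in>nbhd n. \<bar>w x * (f x * L (cutoff n) x)\<bar>)"
        by simp
      also have "\<dots> \<le> (\<Sum>x\<in>nbhd n. \<bar>K\<bar> * (w x * \<bar>L (cutoff n) x\<bar>))"
      proof (rule sum_mono)
        fix x assume "x \<in> nbhd n"
        then have x: "x \<in> X" using nbhd by blast
        have "\<bar>f x\<bar> * (w x * \<bar>L (cutoff n) x\<bar>) \<le> \<bar>K\<bar> * (w x * \<bar>L (cutoff n) x\<bar>)"
          using f[OF x] w_pos[OF x] by (intro mult_right_mono) auto
        then show "\<bar>w x * (f x * L (cutoff n) x)\<bar> \<le> \<bar>K\<bar> * (w x * \<bar>L (cutoff n) x\<bar>)"
          using w_pos[OF x] by (simp add: abs_mult mult.left_commute)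
      qed
      also have "\<dots> = \<bar>K\<bar> * (\<Sum>x\<in>nbhd n. w x * \<bar>L (cutoff n) x\<bar>)" by (simp add: sum_distrib_left)
      also have "\<dots> \<le> \<bar>K\<bar> * (2 * (\<Sum>\<^sub>\<infinity>x\<in>X. w x * defect n x))"
        by (intro mult_left_mono sum_abs_L_cutoff_le) simp
      finally show "norm (a n) \<le> \<bar>K\<bar> * (2 * (\<Sum>\<^sub>\<infinity>x\<in>X. w x * defect n x))" .
    qed
    have "(\<lambda>n. \<Sum>\<^sub>\<infinity>x\<in>X. w x * defect n x) \<longlonglongrightarrow> (\<Sum>\<^sub>\<infinity>x\<in>X. w x * 0)"
      by (rule infsum_dominated_convergence[OF w_summable defect_bounds(2) defect_tendsto])
    then have "(\<lambda>n. \<Sum>\<^sub>\<infinity>x\<in>X. w x * defect n x) \<longlonglongrightarrow> 0" by simp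
    then show "(\<lambda>n. \<bar>K\<bar> * (2 * (\<Sum>\<^sub>\<infinity>x\<in>X. w x * defect n x))) \<longlonglongrightarrow> 0"
      by (intro tendsto_mult_right_zero)
  qed
  ultimately have "(\<Sum>\<^sub>\<infinity>x\<in>X. w x * (1 * L f x)) = 0" by (rule LIMSEQ_unique)
  then show ?thesis by simp
qed

text \<open>Both \<open>f\<close> and \<open>G f\<close> lie in \<open>C0\<close> for
  \<open>f\<close> in the domain, hence are bounded, which is what \<open>infsum_L_eq_0\<close> asks
  for.\<close>

theorem stationary:
  assumes Q: "feller_semigroup X Q"
    and G: "\<And>f. G f = (\<lambda>x. if x \<in> X then L f x else 0)"
    and gen: "has_generator X Q G (\<lambda>f. C0 X (G f))"
    and t: "0 \<le> t" and f: "C0 X f"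
  shows "(\<Sum>\<^sub>\<infinity>x\<in>X. w x * Q t f x) = (\<Sum>\<^sub>\<infinity>x\<in>X. w x * f x)"
proof (rule feller_stationaryI[OF Q gen w_summable _ _ _ t f])
  show "0 \<le> w x" if "x \<in> X" for x using w_pos[OF that] by simp
next
  fix f :: "'a \<Rightarrow> real"
  assume supp: "finite {x. f x \<noteq> 0}" "{x. f x \<noteq> 0} \<subseteq> X"
  define B where "B = {x. f x \<noteq> 0} \<union> (\<Union>s\<in>{x. f x \<noteq> 0}. nbrs s)"
  have "finite B" using supp finite_nbrs by (auto simp: B_def nbrs_def)
  moreover have "G f x = 0" if "x \<notin> B" for x
    using L_finite_support[OF supp _, where x = x] that by (auto simp: G B_def)
  then have "{x. G f x \<noteq> 0} \<subseteq> B" by blast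
  ultimately show "C0 X (G f)"
    by (intro C0_finite_support) (auto intro: finite_subset simp: G split: if_splits)
next
  fix f assume f: "C0 X f" and Gf: "C0 X (G f)"
  obtain K K' where K: "\<And>x. \<bar>f x\<bar> \<le> K" and K': "\<And>x. \<bar>G f x\<bar> \<le> K'"
    using C0_bounded[OF f] C0_bounded[OF Gf] by metis
  have "\<bar>L f x\<bar> \<le> K'" if "x \<in> X" for x using K'[of x] that by (simp add: G)
  with K have "(\<Sum>\<^sub>\<infinity>x\<in>X. w x * L f x) = 0" by (intro infsum_L_eq_0)
  moreover have "(\<Sum>\<^sub>\<infinity>x\<in>X. w x * G f x) = (\<Sum>\<^sub>\<infinity>x\<in>X. w x * L f x)"
    by (rule infsum_cong) (simp add: G)
  ultimately show "(\<Sum>\<^sub>\<infinity>x\<in>X. w x * G f x) = 0" by simp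
qed

end

section \<open>Strictly decreasing integer sequences\<close>

text \<open>A first-order recursion with positive coefficients can be run upwards and downwards from
  0. It is used to pull one complex constant out of the product of reciprocal Gamma values.\<close>

lemma positive_real_multiple_int:
  fixes m :: "int \<Rightarrow> complex" and a b :: "int \<Rightarrow> real"
  assumes pos: "\<And>x. 0 < a x" "\<And>x. 0 < b x"
    and rec: "\<And>x. m (x + 1) * of_real (b (x + 1)) = m x * of_real (a x)"
  shows "\<exists>p>0. m x = m 0 * of_real p"
proof (induction x rule: int_induct[of _ 0])
  case base
  show ?case by (intro exI[of _ 1]) simp
next
  case (step1 i)
  then obtain p where p: "p > 0" "m i = m 0 * of_real p" by blast
  have "m (i + 1) = m 0 * of_real (p * a i / b (i + 1))"
    using rec[of i] p(2) pos(2)[of "i + 1"] by (simp add: field_simps)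
  then show ?case using p(1) pos by (intro exI[of _ "p * a i / b (i + 1)"]) simp
next
  case (step2 i)
  then obtain p where p: "p > 0" "m i = m 0 * of_real p" by blast
  have "m (i - 1) = m 0 * of_real (p * b i / a (i - 1))"
    using rec[of "i - 1"] p(2) pos(1)[of "i - 1"] by (simp add: field_simps)
  then show ?case using p(1) pos by (intro exI[of _ "p * b i / a (i - 1)"]) simp
qed

lemma OmegaD:
  assumes "n \<in> Omega N"
  shows Omega_length: "length n = N" and Omega_less: "i < j \<Longrightarrow> j < N \<Longrightarrow> n ! j < n ! i"
  using assms by (auto simp: Omega_def sorted_wrt_iff_nth_less)

lemma inj_on_Omega: "n \<in> Omega N \<Longrightarrow> inj_on (\<lambda>k. real_of_int (n ! k)) {..<N}"
  by (rule linorder_inj_onI) (use Omega_less in fastforce)+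

lemma length_shift [simp]: "length (shift n k d) = length n"
  by (simp add: shift_def)

lemma nth_shift: "k < length n \<Longrightarrow> shift n k d ! j = (if j = k then n ! k + d else n ! j)"
  by (simp add: shift_def)

lemma shift_shift: "k < length n \<Longrightarrow> shift (shift n k d) k (- d) = n"
  by (simp add: shift_def)

lemma finite_pairs: "finite {(i, j). i < j \<and> j < (N::nat)}"
  by (rule finite_subset[of _ "{..<N} \<times> {..<N}"]) auto

lemma vdm_pos: "n \<in> Omega N \<Longrightarrow> 0 < vdm n"
  unfolding vdm_def by (rule prod_pos) (auto simp: Omega_length Omega_less)

text \<open>A unit step of one entry in a strictly decreasing integer sequence breaks the order only
  by making two entries equal. Hence jumps out of \<open>Omega N\<close> have rate 0.\<close>

lemma vdm_shift_eq_0: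
  assumes n: "n \<in> Omega N" and k: "k < N" and d: "\<bar>d\<bar> = 1" and s: "shift n k d \<notin> Omega N"
  shows "vdm (shift n k d) = 0"
proof -
  have len: "length n = N" using n by (rule Omega_length)
  obtain i j where ij: "i < j" "j < N" "\<not> shift n k d ! j < shift n k d ! i"
    using s len by (auto simp: Omega_def sorted_wrt_iff_nth_less)
  have "shift n k d ! i = shift n k d ! j"
    using ij Omega_less[OF n ij(1,2)] d k len by (auto simp: nth_shift split: if_splits)
  then show ?thesis
    unfolding vdm_def using ij len finite_pairs by (intro prod_zero) auto
qed

lemma vdm_shift_nonneg:
  assumes "n \<in> Omega N" "k < N" "\<bar>d\<bar> = 1"
  shows "0 \<le> vdm (shift n k d)"
  using vdm_shift_eq_0[OF assms] vdm_pos[of "shift n k d" N] by fastforce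

text \<open>Only pairs containing \<open>k\<close> change. For \<open>j\<close> before
  \<open>k\<close> the quotient is \<open>1 - d / (n ! j - n ! k)\<close>, so both orders of the
  pair give the same expression.\<close>

lemma vdm_shift_ratio:
  assumes n: "n \<in> Omega N" and k: "k < N"
  shows "vdm (shift n k d) / vdm n =
    (\<Prod>j\<in>{..<N} - {k}. 1 + of_int d / (real_of_int (n ! k) - real_of_int (n ! j)))"
proof -
  have len: "length n = N" using n by (rule Omega_length)
  define P where "P = {(i, j). i < j \<and> j < N}"
  define r where "r = (\<lambda>(i, j). real_of_int (shift n k d ! i - shift n k d ! j) / real_of_int (n ! i - n ! j))"
  have ne: "real_of_int (n ! i) - real_of_int (n ! j) \<noteq> 0" if "i < j" "j < N" for i j
    using Omega_less[OF n that] by simp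
  have "vdm (shift n k d) / vdm n = prod r P"
    by (simp add: vdm_def len prod_dividef[symmetric] r_def P_def case_prod_unfold)
  also have "\<dots> = prod r {(i, j) \<in> P. i = k \<or> j = k}"
    by (rule prod.mono_neutral_right) (use finite_pairs ne k len in \<open>auto simp: P_def r_def nth_shift split: if_splits\<close>)
  also have "\<dots> = (\<Prod>j\<in>{..<N} - {k}. 1 + of_int d / (real_of_int (n ! k) - real_of_int (n ! j)))"
  \<comment> \<open>A pair containing \<open>k\<close> is encoded by its other member.\<close>
  proof (rule prod.reindex_bij_witness[where i = "\<lambda>j. if j < k then (j, k) else (k, j)"
        and j = "\<lambda>(i, j). if i = k then j else i"])
    fix a assume a: "a \<in> {(i, j) \<in> P. i = k \<or> j = k}"
    obtain i j where ij: "a = (i, j)" "i < j" "j < N" "i = k \<or> j = k" using a by (auto simp: P_def)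
    from ij(4) show "1 + of_int d / (real_of_int (n ! k) - real_of_int (n ! (case a of (i, j) \<Rightarrow> if i = k then j else i))) = r a"
    proof
      assume "i = k"
      then show ?thesis using ij ne[of i j] k len by (simp add: r_def nth_shift field_simps)
    next
      assume "j = k"
      then show ?thesis using ij ne[of i j] k len by (simp add: r_def nth_shift field_simps)
    qed
  qed (use k in \<open>auto simp: P_def split: if_splits\<close>)
  finally show ?thesis .
qed

lemma finite_Omega_sum_squares_less:
  "finite {n \<in> Omega N. (\<Sum>k<N. (real_of_int (n ! k))\<^sup>2) < R}"
proof (rule finite_subset)
  define M where "M = \<lceil>max 0 R\<rceil>"
  show "finite {n. set n \<subseteq> {- M..M} \<and> length n = N}" by (rule finite_lists_length_eq) simp
  show "{n \<in> Omega N. (\<Sum>k<N. (real_of_int (n ! k))\<^sup>2) < R} \<subseteq> {n. set n \<subseteq> {- M..M} \<and> length n = N}"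
  proof safe
    fix n y assume n: "n \<in> Omega N" and less: "(\<Sum>k<N. (real_of_int (n ! k))\<^sup>2) < R" and y: "y \<in> set n"
    obtain k where k: "k < N" "y = n ! k" using y Omega_length[OF n] by (metis in_set_conv_nth)
    \<comment> \<open>An integer satisfies \<open>\<bar>y\<bar> \<le> y^2\<close>, so the sum of
      squares bounds the entries themselves.\<close>
    have "\<bar>real_of_int y\<bar> * 1 \<le> \<bar>real_of_int y\<bar> * \<bar>real_of_int y\<bar>" if "y \<noteq> 0"
      using that by (intro mult_left_mono) auto
    then have "\<bar>real_of_int y\<bar> \<le> (real_of_int y)\<^sup>2"
      by (cases "y = 0") (auto simp: power2_eq_square)
    also have "\<dots> \<le> (\<Sum>k<N. (real_of_int (n ! k))\<^sup>2)" unfolding k(2) by (rule member_le_sum) (use k in auto)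
    finally have "\<bar>real_of_int y\<bar> \<le> max 0 R" using less by simp
    then have "\<bar>y\<bar> \<le> M" unfolding M_def by linarith
    then show "y \<in> {- M..M}" by auto
  qed (rule Omega_length)
qed

lemma n_to_sig_sig_to_n: "\<nu> \<in> Sig N \<Longrightarrow> n_to_sig N (sig_to_n N \<nu>) = \<nu>"
  by (auto simp: Sig_def sig_to_n_def n_to_sig_def intro!: nth_equalityI)

text \<open>The staircase \<open>N - 1 - j\<close> drops by one at each index and so turns weak
  descent into strict descent; by transitivity adjacent entries suffice.\<close>

lemma bij_betw_sig_to_n: "bij_betw (sig_to_n N) (Sig N) (Omega N)"
proof (rule bij_betwI[where g = "n_to_sig N"])
  show "sig_to_n N \<in> Sig N \<rightarrow> Omega N"
  proof
    fix \<nu> assume \<nu>: "\<nu> \<in> Sig N"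
    have "sorted_wrt (>) (sig_to_n N \<nu>)"
    proof (subst sorted_wrt_iff_nth_Suc_transp)
      have "\<nu> ! Suc i \<le> \<nu> ! i" if "Suc i < N" for i
        using \<nu> that by (auto simp: Sig_def sorted_wrt_iff_nth_less)
      then show "\<forall>i. Suc i < length (sig_to_n N \<nu>) \<longrightarrow> sig_to_n N \<nu> ! Suc i < sig_to_n N \<nu> ! i"
        by (fastforce simp: sig_to_n_def of_nat_diff)
    qed (auto simp: transp_def)
    then show "sig_to_n N \<nu> \<in> Omega N" by (simp add: Omega_def sig_to_n_def)
  qed
  show "n_to_sig N \<in> Omega N \<rightarrow> Sig N"
  proof
    fix n assume n: "n \<in> Omega N"
    have "sorted_wrt (\<ge>) (n_to_sig N n)"
    proof (subst sorted_wrt_iff_nth_Suc_transp)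
      show "\<forall>i. Suc i < length (n_to_sig N n) \<longrightarrow> n_to_sig N n ! Suc i \<le> n_to_sig N n ! i"
        using Omega_less[OF n lessI] by (fastforce simp: n_to_sig_def of_nat_diff)
    qed (auto simp: transp_def)
    then show "n_to_sig N n \<in> Sig N" by (simp add: Sig_def n_to_sig_def)
  qed
qed (auto simp: Sig_def Omega_def sig_to_n_def n_to_sig_def intro!: nth_equalityI)

section \<open>The zw-measures\<close>

locale zw_chain =
  fixes z z' w w' :: complex and N :: nat
  assumes admissible: "admissible z z' w w'"
    and N: "1 \<le> N"
begin

definition up :: "int \<Rightarrow> real" where
  "up x = Re ((z + of_nat N - 1 - of_int x) * (z' + of_nat N - 1 - of_int x))"

definition down :: "int \<Rightarrow> real" where
  "down x = Re ((w + of_int x) * (w' + of_int x))"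

text \<open>The factor of \<open>zw_weight\<close> at one coordinate, in terms of
  \<open>x = n ! j\<close> instead of \<open>\<nu> ! j\<close>. It is kept complex, since only
  ratios of its values are shown to be real.\<close>

definition m :: "int \<Rightarrow> complex" where
  "m x = rGamma (z + of_nat N - of_int x) * rGamma (z' + of_nat N - of_int x)
    * rGamma (w + 1 + of_int x) * rGamma (w' + 1 + of_int x)"

lemma up:
  shows up_pos: "0 < up x"
    and of_real_up: "of_real (up x) = (z + of_nat N - 1 - of_int x) * (z' + of_nat N - 1 - of_int x)"
proof -
  have eq: "u + of_int (int N - 1 - x) = u + of_nat N - 1 - of_int x" for u :: complex by simp
  have "\<forall>k::int. (z + of_int k) * (z' + of_int k) \<in> \<real> \<and> 0 < Re ((z + of_int k) * (z' + of_int k))"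
    using admissible unfolding admissible_def by blast
  from this[rule_format, of "int N - 1 - x"]
  have *: "(z + of_nat N - 1 - of_int x) * (z' + of_nat N - 1 - of_int x) \<in> \<real> \<and> 0 < up x"
    unfolding eq up_def .
  then show "0 < up x" ..
  show "of_real (up x) = (z + of_nat N - 1 - of_int x) * (z' + of_nat N - 1 - of_int x)"
    unfolding up_def by (rule of_real_Re[OF conjunct1[OF *]])
qed

lemma down:
  shows down_pos: "0 < down x"
    and of_real_down: "of_real (down x) = (w + of_int x) * (w' + of_int x)"
proof -
  have *: "(w + of_int x) * (w' + of_int x) \<in> \<real> \<and> 0 < down x"
    using admissible unfolding admissible_def down_def by blast
  then show "0 < down x" ..
  show "of_real (down x) = (w + of_int x) * (w' + of_int x)"
    unfolding down_def by (rule of_real_Re[OF conjunct1[OF *]])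
qed

text \<open>Detailed balance for a single coordinate, from the functional equation of the Gamma
  function.\<close>

lemma m_rec: "m (x + 1) * of_real (down (x + 1)) = m x * of_real (up x)"
proof -
  have up_step: "rGamma (u + of_nat N - of_int (x + 1)) =
      (u + of_nat N - 1 - of_int x) * rGamma (u + of_nat N - of_int x)" for u :: complex
    using rGamma_plus1[of "u + of_nat N - 1 - of_int x"] by (simp add: algebra_simps)
  have down_step: "rGamma (u + 1 + of_int x) =
      (u + of_int (x + 1)) * rGamma (u + 1 + of_int (x + 1))" for u :: complex
    using rGamma_plus1[of "u + 1 + of_int x"] by (simp add: algebra_simps)
  have "m (x + 1) * ((w + of_int (x + 1)) * (w' + of_int (x + 1))) =
      m x * ((z + of_nat N - 1 - of_int x) * (z' + of_nat N - 1 - of_int x))"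
    unfolding m_def up_step down_step by (simp only: ac_simps)
  then show ?thesis by (simp only: of_real_up of_real_down)
qed

text \<open>The ratio \<open>m x / m 0\<close> when \<open>m 0\<close> is nonzero; the choice yields
  a positive number also when \<open>m 0 = 0\<close>.\<close>

definition p :: "int \<Rightarrow> real" where
  "p x = (SOME p. 0 < p \<and> m x = m 0 * of_real p)"

lemma p: "0 < p x" "m x = m 0 * of_real (p x)"
proof -
  have "\<exists>p>0. m x = m 0 * of_real p"
    using up_pos down_pos m_rec by (rule positive_real_multiple_int)
  then have "0 < p x \<and> m x = m 0 * of_real (p x)" unfolding p_def by (rule someI_ex)
  then show "0 < p x" "m x = m 0 * of_real (p x)" by blast+
qed

lemma p_rec:
  assumes "m 0 \<noteq> 0"
  shows "p (x + 1) * down (x + 1) = p x * up x"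
proof -
  have "m 0 * of_real (p (x + 1) * down (x + 1)) = m 0 * of_real (p x * up x)"
    using m_rec[of x] unfolding p(2)[of "x + 1"] p(2)[of x] by simp
  then show ?thesis using assms by (metis mult_cancel_left of_real_eq_iff)
qed

text \<open>The zw-weight on \<open>Omega N\<close> stripped of constants: \<open>p\<close> replaces
  \<open>m\<close>, and \<open>vdm\<close> replaces \<open>Dim\<close>.\<close>

definition W :: "int list \<Rightarrow> real" where
  "W n = (\<Prod>j<N. p (n ! j)) * (vdm n)\<^sup>2"

lemma W_pos: "n \<in> Omega N \<Longrightarrow> 0 < W n"
  unfolding W_def using p(1) vdm_pos by (intro mult_pos_pos prod_pos zero_less_power) auto

text \<open>\<open>K\<close> collects \<open>Re (m 0 ^ N)\<close> and the squared denominator of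
  \<open>Dim\<close>. The real part splits as claimed because the product of the \<open>p\<close> is
  real.\<close>

lemma zw_weight_eq:
  obtains K where "K \<noteq> 0 \<longrightarrow> m 0 \<noteq> 0"
    "\<And>\<nu>. zw_weight z z' w w' N \<nu> = K * W (sig_to_n N \<nu>)"
proof
  define P where "P = {(i, j). i < j \<and> j < N}"
  define d where "d = (\<Prod>(i, j)\<in>P. real j - real i)"
  \<comment> \<open>Here \<open>1 \<le> N\<close> matters: it makes \<open>0 ^ N\<close>
    vanish.\<close>
  show "Re (m 0 ^ N) / d\<^sup>2 \<noteq> 0 \<longrightarrow> m 0 \<noteq> 0" using N by auto
  fix \<nu>
  define n where "n = sig_to_n N \<nu>"
  have nth: "n ! j = \<nu> ! j + int (N - 1 - j)" if "j < N" for j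
    using that by (simp add: n_def sig_to_n_def)
  have "Dim N \<nu> = vdm n / d"
  proof -
    have "Dim N \<nu> = (\<Prod>(i, j)\<in>P. real_of_int (n ! i - n ! j) / (real j - real i))"
      unfolding Dim_def P_def by (intro prod.cong) (auto simp: nth of_nat_diff)
    also have "\<dots> = vdm n / d"
      unfolding d_def vdm_def P_def by (simp add: n_def sig_to_n_def prod_dividef case_prod_unfold)
    finally show ?thesis .
  qed
  moreover have "(\<Prod>j<N. rGamma (z - of_int (\<nu> ! j) + of_nat j + 1) * rGamma (z' - of_int (\<nu> ! j) + of_nat j + 1)
       * rGamma (w + of_nat N + of_int (\<nu> ! j) - of_nat j) * rGamma (w' + of_nat N + of_int (\<nu> ! j) - of_nat j))
     = (\<Prod>j<N. m (n ! j))"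
  proof (rule prod.cong[OF refl])
    fix j assume "j \<in> {..<N}"
    then have j: "j < N" by simp
    have "u - of_int (\<nu> ! j) + of_nat j + 1 = u + of_nat N - of_int (n ! j)"
      "u + of_nat N + of_int (\<nu> ! j) - of_nat j = u + 1 + of_int (n ! j)" for u :: complex
      using j by (simp_all add: nth of_nat_diff)
    then show "rGamma (z - of_int (\<nu> ! j) + of_nat j + 1) * rGamma (z' - of_int (\<nu> ! j) + of_nat j + 1)
       * rGamma (w + of_nat N + of_int (\<nu> ! j) - of_nat j) * rGamma (w' + of_nat N + of_int (\<nu> ! j) - of_nat j)
       = m (n ! j)"
      by (simp only: m_def)
  qed
  moreover have "(\<Prod>j<N. m (n ! j)) = m 0 ^ N * of_real (\<Prod>j<N. p (n ! j))"
    by (subst p(2)) (simp add: prod.distrib)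
  ultimately have "zw_weight z z' w w' N \<nu> =
      Re (m 0 ^ N * of_real (\<Prod>j<N. p (n ! j))) * (vdm n / d)\<^sup>2"
    by (simp only: zw_weight_def)
  also have "\<dots> = Re (m 0 ^ N) * (\<Prod>j<N. p (n ! j)) * (vdm n / d)\<^sup>2"
    by (simp del: of_real_prod)
  finally show "zw_weight z z' w w' N \<nu> = Re (m 0 ^ N) / d\<^sup>2 * W (sig_to_n N \<nu>)"
    by (simp add: W_def n_def power_divide)
qed

section \<open>Jump rates and detailed balance\<close>

definition rate_up :: "int list \<Rightarrow> nat \<Rightarrow> real" where
  "rate_up n k = vdm (shift n k 1) / vdm n * up (n ! k)"

definition rate_down :: "int list \<Rightarrow> nat \<Rightarrow> real" where
  "rate_down n k = vdm (shift n k (- 1)) / vdm n * down (n ! k)"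

text \<open>Summing over all moves avoids proving that different moves have different
  targets.\<close>

definition q :: "int list \<Rightarrow> int list \<Rightarrow> real" where
  "q n l = (\<Sum>k<N. (if l = shift n k 1 then rate_up n k else 0) + (if l = shift n k (- 1) then rate_down n k else 0))"

lemma rates:
  assumes "n \<in> Omega N" "k < N"
  shows rate_up_nonneg: "0 \<le> rate_up n k" and rate_down_nonneg: "0 \<le> rate_down n k"
  using vdm_shift_nonneg[OF assms, of 1] vdm_shift_nonneg[OF assms, of "- 1"] vdm_pos[OF assms(1)]
    up_pos[of "n ! k"] down_pos[of "n ! k"]
  by (simp_all add: rate_up_def rate_down_def)

lemma zw_D_eq: "zw_D z z' w w' N f n = (\<Sum>k<N. rate_up n k * (f (shift n k 1) - f n) + rate_down n k * (f (shift n k (- 1)) - f n))"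
  by (simp add: zw_D_def rate_up_def rate_down_def up_def down_def)

definition shifts :: "int list \<Rightarrow> int list set" where
  "shifts n = (\<lambda>k. shift n k 1) ` {..<N} \<union> (\<lambda>k. shift n k (- 1)) ` {..<N}"

lemma finite_shifts: "finite (shifts n)"
  by (simp add: shifts_def)

lemma q_eq_0: "l \<notin> shifts n \<Longrightarrow> q n l = 0"
  unfolding q_def by (intro sum.neutral) (auto simp: shifts_def)

lemma finite_q: "finite {l \<in> X. q n l \<noteq> 0}"
  by (rule finite_subset[OF _ finite_shifts[of n]]) (use q_eq_0 in blast)

text \<open>Moves that leave \<open>Omega N\<close> carry rate 0, so the operator is the generator
  of a jump chain on \<open>Omega N\<close> itself.\<close>

lemma zw_D_eq_sum:
  assumes n: "n \<in> Omega N"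
  shows "zw_D z z' w w' N f n = (\<Sum>l | l \<in> Omega N \<and> q n l \<noteq> 0. q n l * (f l - f n))"
proof -
  define S where "S = shifts n"
  have S: "finite S" by (simp add: S_def finite_shifts)
  have "(\<Sum>l | l \<in> Omega N \<and> q n l \<noteq> 0. q n l * (f l - f n)) = (\<Sum>l\<in>S \<inter> Omega N. q n l * (f l - f n))"
    using S q_eq_0[of _ n] by (intro sum.mono_neutral_left) (auto simp: S_def)
  also have "\<dots> = (\<Sum>l\<in>S \<inter> Omega N. \<Sum>k<N. (if l = shift n k 1 then rate_up n k * (f l - f n) else 0) +
      (if l = shift n k (- 1) then rate_down n k * (f l - f n) else 0))"
    unfolding q_def sum_distrib_right by (intro sum.cong refl) (simp add: algebra_simps)
  also have "\<dots> = (\<Sum>k<N. \<Sum>l\<in>S \<inter> Omega N. (if l = shift n k 1 then rate_up n k * (f l - f n) else 0) +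
      (if l = shift n k (- 1) then rate_down n k * (f l - f n) else 0))"
    by (rule sum.swap)
  also have "\<dots> = zw_D z z' w w' N f n"
    unfolding zw_D_eq
  proof (rule sum.cong[OF refl])
    fix k assume k: "k \<in> {..<N}"
    have "(\<Sum>l\<in>S \<inter> Omega N. if l = shift n k d then c * (f l - f n) else 0) = c * (f (shift n k d) - f n)"
      if "shift n k d \<in> S" "shift n k d \<notin> Omega N \<Longrightarrow> c = 0" for c d
      using S that by (cases "shift n k d \<in> Omega N") (auto simp: sum.delta)
    moreover have "shift n k 1 \<in> S" "shift n k (- 1) \<in> S" using k by (auto simp: S_def shifts_def)
    moreover have "rate_up n k = 0" if "shift n k 1 \<notin> Omega N"
      using vdm_shift_eq_0[OF n _ _ that] k by (simp add: rate_up_def)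
    moreover have "rate_down n k = 0" if "shift n k (- 1) \<notin> Omega N"
      using vdm_shift_eq_0[OF n _ _ that] k by (simp add: rate_down_def)
    ultimately show "(\<Sum>l\<in>S \<inter> Omega N. (if l = shift n k 1 then rate_up n k * (f l - f n) else 0) +
        (if l = shift n k (- 1) then rate_down n k * (f l - f n) else 0)) =
      rate_up n k * (f (shift n k 1) - f n) + rate_down n k * (f (shift n k (- 1)) - f n)"
      by (simp add: sum.distrib)
  qed
  finally show ?thesis by simp
qed

text \<open>The Vandermonde factors combine to \<open>vdm n * vdm l\<close>, which is symmetric, and
  the moved coordinate is handled by \<open>p_rec\<close>; the other coordinates form the common
  factor \<open>R\<close>.\<close>

lemma W_rate_up:
  assumes m0: "m 0 \<noteq> 0" and n: "n \<in> Omega N" and l: "l \<in> Omega N" and k: "k < N" and eq: "l = shift n k 1"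
  shows "W n * rate_up n k = W l * rate_down l k"
proof -
  have len: "length n = N" using n by (rule Omega_length)
  define R where "R = (\<Prod>j\<in>{..<N} - {k}. p (n ! j))"
  have n_prod: "(\<Prod>j<N. p (n ! j)) = p (n ! k) * R"
    unfolding R_def using k by (intro prod.remove) auto
  have "(\<Prod>j<N. p (l ! j)) = p (l ! k) * (\<Prod>j\<in>{..<N} - {k}. p (l ! j))"
    using k by (intro prod.remove) auto
  also have "(\<Prod>j\<in>{..<N} - {k}. p (l ! j)) = R"
    unfolding R_def by (intro prod.cong) (auto simp: eq nth_shift len k)
  finally have l_prod: "(\<Prod>j<N. p (l ! j)) = p (n ! k + 1) * R"
    by (simp add: eq nth_shift len k)
  have shift_back: "shift l k (- 1) = n" using shift_shift[of k n 1] k len by (simp add: eq)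
  have lk: "l ! k = n ! k + 1" by (simp add: eq nth_shift len k)
  have "W n * rate_up n k = (p (n ! k) * up (n ! k)) * R * vdm n * vdm l"
    using vdm_pos[OF n] by (simp add: W_def n_prod rate_up_def eq[symmetric] power2_eq_square)
  also have "\<dots> = (p (n ! k + 1) * down (n ! k + 1)) * R * vdm n * vdm l"
    by (simp only: p_rec[OF m0])
  also have "\<dots> = W l * rate_down l k"
    using vdm_pos[OF l] by (simp add: W_def l_prod rate_down_def shift_back lk power2_eq_square)
  finally show ?thesis .
qed

text \<open>For each index an up-jump is matched with the down-jump that reverses it, so
  \<open>W_rate_up\<close>, used in both directions, covers all moves.\<close>

lemma W_q_sym:
  assumes m0: "m 0 \<noteq> 0" and n: "n \<in> Omega N" and l: "l \<in> Omega N"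
  shows "W n * q n l = W l * q l n"
proof -
  have sym: "a = shift b k d \<longleftrightarrow> b = shift a k (- d)" if "k < N" "a \<in> Omega N" "b \<in> Omega N" for a b k d
    using shift_shift[of k b d] shift_shift[of k a "- d"] Omega_length that by auto
  show ?thesis
    unfolding q_def sum_distrib_left
  proof (rule sum.cong[OF refl])
    fix k assume "k \<in> {..<N}"
    then have k: "k < N" by simp
    show "W n * ((if l = shift n k 1 then rate_up n k else 0) + (if l = shift n k (- 1) then rate_down n k else 0)) =
      W l * ((if n = shift l k 1 then rate_up l k else 0) + (if n = shift l k (- 1) then rate_down l k else 0))"
    proof -
      have "(if l = shift n k 1 then W n * rate_up n k else 0) = (if n = shift l k (- 1) then W l * rate_down l k else 0)"
        by (rule if_cong[OF sym[OF k l n]]) (use sym[OF k l n, of 1] W_rate_up[OF m0 n l k] in blast)+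
      moreover have "(if n = shift l k 1 then W l * rate_up l k else 0) = (if l = shift n k (- 1) then W n * rate_down n k else 0)"
        by (rule if_cong[OF sym[OF k n l]]) (use sym[OF k n l, of 1] W_rate_up[OF m0 l n k] in blast)+
      moreover have "c * ((if P then a else 0) + (if R then b else 0)) = (if P then c * a else 0) + (if R then c * b else 0)"
        for a b c :: real and P R by (simp add: distrib_left)
      ultimately show ?thesis by (simp only: add.commute)
    qed
  qed
qed

section \<open>Drift of the sum of squares\<close>

definition F :: "int list \<Rightarrow> real" where
  "F n = (\<Sum>k<N. (real_of_int (n ! k))\<^sup>2)"

lemma F_shift:
  assumes "n \<in> Omega N" "k < N"
  shows "F (shift n k d) - F n = (real_of_int (n ! k) + of_int d)\<^sup>2 - (real_of_int (n ! k))\<^sup>2"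
proof -
  have len: "length n = N" using assms(1) by (rule Omega_length)
  have "F (shift n k d) - F n = (\<Sum>j<N. (real_of_int (shift n k d ! j))\<^sup>2 - (real_of_int (n ! j))\<^sup>2)"
    by (simp add: F_def sum_subtractf)
  also have "\<dots> = (\<Sum>j<N. if j = k then (real_of_int (n ! k) + of_int d)\<^sup>2 - (real_of_int (n ! k))\<^sup>2 else 0)"
    using assms len by (intro sum.cong) (auto simp: nth_shift)
  finally show ?thesis using assms(2) by simp
qed

text \<open>Both rate polynomials have leading coefficient one, and the Vandermonde ratios are the
  products in \<open>vsum_drift_bound\<close>. The parameters affect only the lower coefficients and
  thereby \<open>C\<close>.\<close>

lemma drift_bound:
  obtains C where "0 \<le> C" "\<And>n. n \<in> Omega N \<Longrightarrow> zw_D z z' w w' N F n \<le> C * (1 + F n)"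
proof -
  define u u' where "u = z + of_nat N - 1" and "u' = z' + of_nat N - 1"
  have up: "up x = (real_of_int x)\<^sup>2 + (- Re (u + u')) * real_of_int x + Re (u * u')" for x
    unfolding up_def u_def[symmetric] u'_def[symmetric]
    by (simp add: algebra_simps power2_eq_square)
  have down: "down x = (real_of_int x)\<^sup>2 + Re (w + w') * real_of_int x + Re (w * w')" for x
    unfolding down_def by (simp add: algebra_simps power2_eq_square)
  obtain C where C: "0 \<le> C" "\<And>x. inj_on x {..<N} \<Longrightarrow>
    (\<Sum>k<N. (\<Prod>j\<in>{..<N} - {k}. 1 + 1 / (x k - x j)) * ((x k)\<^sup>2 + (- Re (u + u')) * x k + Re (u * u')) * (2 * x k + 1) +
        (\<Prod>j\<in>{..<N} - {k}. 1 + (- 1) / (x k - x j)) * ((x k)\<^sup>2 + Re (w + w') * x k + Re (w * w')) * (1 - 2 * x k))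
    \<le> C * (1 + (\<Sum>k<N. (x k)\<^sup>2))"
    using vsum_drift_bound[of "{..<N}" "- Re (u + u')" "Re (u * u')" "Re (w + w')" "Re (w * w')"]
    by blast
  have "zw_D z z' w w' N F n \<le> C * (1 + F n)" if n: "n \<in> Omega N" for n
  proof -
    define x where "x k = real_of_int (n ! k)" for k
    have "zw_D z z' w w' N F n =
      (\<Sum>k<N. (\<Prod>j\<in>{..<N} - {k}. 1 + 1 / (x k - x j)) * ((x k)\<^sup>2 + (- Re (u + u')) * x k + Re (u * u')) * (2 * x k + 1) +
        (\<Prod>j\<in>{..<N} - {k}. 1 + (- 1) / (x k - x j)) * ((x k)\<^sup>2 + Re (w + w') * x k + Re (w * w')) * (1 - 2 * x k))"
      unfolding zw_D_eq
    proof (rule sum.cong[OF refl])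
      fix k assume "k \<in> {..<N}"
      then have k: "k < N" by simp
      have 1: "rate_up n k = (\<Prod>j\<in>{..<N} - {k}. 1 + 1 / (x k - x j)) * ((x k)\<^sup>2 + (- Re (u + u')) * x k + Re (u * u'))"
        unfolding rate_up_def vdm_shift_ratio[OF n k] up x_def by simp
      have 2: "rate_down n k = (\<Prod>j\<in>{..<N} - {k}. 1 + (- 1) / (x k - x j)) * ((x k)\<^sup>2 + Re (w + w') * x k + Re (w * w'))"
        unfolding rate_down_def vdm_shift_ratio[OF n k] down x_def by simp
      have 3: "F (shift n k 1) - F n = 2 * x k + 1" "F (shift n k (- 1)) - F n = 1 - 2 * x k"
        unfolding F_shift[OF n k] x_def by (simp_all add: power2_eq_square algebra_simps)
      show "rate_up n k * (F (shift n k 1) - F n) + rate_down n k * (F (shift n k (- 1)) - F n) =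
        (\<Prod>j\<in>{..<N} - {k}. 1 + 1 / (x k - x j)) * ((x k)\<^sup>2 + (- Re (u + u')) * x k + Re (u * u')) * (2 * x k + 1) +
        (\<Prod>j\<in>{..<N} - {k}. 1 + (- 1) / (x k - x j)) * ((x k)\<^sup>2 + Re (w + w') * x k + Re (w * w')) * (1 - 2 * x k)"
        unfolding 1 2 3 ..
    qed
    also have "\<dots> \<le> C * (1 + (\<Sum>k<N. (x k)\<^sup>2))"
      by (rule C(2)) (use inj_on_Omega[OF n] in \<open>simp add: x_def[abs_def]\<close>)
    finally show ?thesis by (simp add: F_def x_def)
  qed
  with C(1) show ?thesis by (rule that)
qed

lemma reversible:
  assumes m0: "m 0 \<noteq> 0" and summable: "W summable_on Omega N"
  obtains C where "reversible_chain (Omega N) q W F C"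
proof -
  obtain C where C: "0 \<le> C" "\<And>n. n \<in> Omega N \<Longrightarrow> zw_D z z' w w' N F n \<le> C * (1 + F n)"
    using drift_bound by blast
  have "reversible_chain (Omega N) q W F C"
  proof
    show "0 \<le> q n l" if "n \<in> Omega N" for n l
      unfolding q_def by (intro sum_nonneg) (simp add: rate_up_nonneg rate_down_nonneg that)
    show "finite {l \<in> Omega N. q n l \<noteq> 0}" for n by (rule finite_q)
    show "finite {n \<in> Omega N. F n < R}" for R
      unfolding F_def by (rule finite_Omega_sum_squares_less)
    show "0 \<le> F n" for n unfolding F_def by (simp add: sum_nonneg)
    show "(\<Sum>l | l \<in> Omega N \<and> q n l \<noteq> 0. q n l * (F l - F n)) \<le> C * (1 + F n)" if "n \<in> Omega N" for n
      using C(2)[OF that] unfolding zw_D_eq_sum[OF that] .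
  qed (use C(1) m0 summable W_q_sym W_pos in auto)
  then show ?thesis by (rule that)
qed

lemma zw_gen_stationary:
  assumes m0: "m 0 \<noteq> 0" and summable: "W summable_on Omega N"
    and Q: "feller_semigroup (Omega N) Q"
    and gen: "has_generator (Omega N) Q (zw_gen z z' w w' N) (\<lambda>f. C0 (Omega N) (zw_gen z z' w w' N f))"
    and t: "0 \<le> t" and f: "C0 (Omega N) f"
  shows "(\<Sum>\<^sub>\<infinity>n\<in>Omega N. W n * Q t f n) = (\<Sum>\<^sub>\<infinity>n\<in>Omega N. W n * f n)"
proof -
  obtain C where "reversible_chain (Omega N) q W F C" using reversible[OF m0 summable] .
  then interpret reversible_chain "Omega N" q W F C .
  have "zw_gen z z' w w' N f = (\<lambda>n. if n \<in> Omega N then L f n else 0)" for f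
    by (auto simp: zw_gen_def zw_D_eq_sum L_def nbrs_def)
  then show ?thesis by (rule stationary[OF Q _ gen t f])
qed

end

section \<open>Transfer to signatures\<close>

lemma C0_n_to_sig:
  assumes "C0 (Sig N) f"
  shows "C0 (Omega N) (\<lambda>n. if n \<in> Omega N then f (n_to_sig N n) else 0)"
  unfolding C0_def
proof (intro conjI allI impI)
  fix e :: real assume "0 < e"
  then have "finite (sig_to_n N ` {\<nu> \<in> Sig N. e \<le> \<bar>f \<nu>\<bar>})" using assms by (simp add: C0_def)
  then show "finite {n \<in> Omega N. e \<le> \<bar>if n \<in> Omega N then f (n_to_sig N n) else 0\<bar>}"
  proof (rule finite_subset[rotated], safe)
    fix n assume n: "n \<in> Omega N" and e: "e \<le> \<bar>if n \<in> Omega N then f (n_to_sig N n) else 0\<bar>"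
    obtain \<nu> where \<nu>: "\<nu> \<in> Sig N" "n = sig_to_n N \<nu>"
      using n bij_betw_sig_to_n[of N] by (auto simp: bij_betw_def)
    then show "n \<in> sig_to_n N ` {\<nu> \<in> Sig N. e \<le> \<bar>f \<nu>\<bar>}" using n e by (auto simp: n_to_sig_sig_to_n)
  qed
qed simp

theorem theorem5:
  fixes z z' w w' :: complex and N :: nat
    and Q :: "real \<Rightarrow> (int list \<Rightarrow> real) \<Rightarrow> int list \<Rightarrow> real"
  assumes "admissible z z' w w'"
    and "N \<ge> 1"
    and "feller_semigroup (Omega N) Q"
    and "has_generator (Omega N) Q (zw_gen z z' w w' N)
           (\<lambda>f. C0 (Omega N) (zw_gen z z' w w' N f))"
  shows "\<forall>t\<ge>0. \<forall>f. C0 (Sig N) f \<longrightarrow>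
           (\<Sum>\<^sub>\<infinity>\<nu>\<in>Sig N. zw_measure z z' w w' N \<nu> * transport_sg N Q t f \<nu>)
         = (\<Sum>\<^sub>\<infinity>\<nu>\<in>Sig N. zw_measure z z' w w' N \<nu> * f \<nu>)"
proof (intro allI impI)
  fix t :: real and f assume t: "0 \<le> t" and f: "C0 (Sig N) f"
  interpret zw_chain z z' w w' N using assms(1,2) by unfold_locales
  define Z where "Z = (\<Sum>\<^sub>\<infinity>\<mu>\<in>Sig N. zw_weight z z' w w' N \<mu>)"
  define g where "g n = (if n \<in> Omega N then f (n_to_sig N n) else 0)" for n
  obtain K where K: "K \<noteq> 0 \<longrightarrow> m 0 \<noteq> 0" "\<And>\<nu>. zw_weight z z' w w' N \<nu> = K * W (sig_to_n N \<nu>)"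
    using zw_weight_eq by blast
  have reindex: "(\<Sum>\<^sub>\<infinity>\<nu>\<in>Sig N. h (sig_to_n N \<nu>)) = (\<Sum>\<^sub>\<infinity>n\<in>Omega N. h n)" for h :: "int list \<Rightarrow> real"
    by (rule infsum_reindex_bij_betw[OF bij_betw_sig_to_n])
  have measure: "zw_measure z z' w w' N \<nu> = K / Z * W (sig_to_n N \<nu>)" for \<nu>
    by (simp add: zw_measure_def Z_def K(2))
  \<comment> \<open>Both sides of the theorem become the same multiple \<open>K / Z\<close> of a sum
    over \<open>Omega N\<close>.\<close>
  have expect: "(\<Sum>\<^sub>\<infinity>\<nu>\<in>Sig N. zw_measure z z' w w' N \<nu> * h \<nu>) = K / Z * (\<Sum>\<^sub>\<infinity>n\<in>Omega N. W n * h' n)"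
    if "\<And>\<nu>. \<nu> \<in> Sig N \<Longrightarrow> h \<nu> = h' (sig_to_n N \<nu>)" for h h'
  proof -
    have "(\<Sum>\<^sub>\<infinity>\<nu>\<in>Sig N. zw_measure z z' w w' N \<nu> * h \<nu>) = (\<Sum>\<^sub>\<infinity>\<nu>\<in>Sig N. K / Z * (W (sig_to_n N \<nu>) * h' (sig_to_n N \<nu>)))"
      by (rule infsum_cong) (simp add: measure that)
    also have "\<dots> = K / Z * (\<Sum>\<^sub>\<infinity>n\<in>Omega N. W n * h' n)"
      unfolding infsum_cmult_right' reindex[of "\<lambda>n. W n * h' n"] ..
    finally show ?thesis .
  qed
  have lhs: "(\<Sum>\<^sub>\<infinity>\<nu>\<in>Sig N. zw_measure z z' w w' N \<nu> * transport_sg N Q t f \<nu>) = K / Z * (\<Sum>\<^sub>\<infinity>n\<in>Omega N. W n * Q t g n)"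
    by (rule expect) (simp add: transport_sg_def g_def[abs_def])
  have rhs: "(\<Sum>\<^sub>\<infinity>\<nu>\<in>Sig N. zw_measure z z' w w' N \<nu> * f \<nu>) = K / Z * (\<Sum>\<^sub>\<infinity>n\<in>Omega N. W n * g n)"
    by (rule expect) (use bij_betwE[OF bij_betw_sig_to_n] in \<open>auto simp: g_def n_to_sig_sig_to_n\<close>)
  show "(\<Sum>\<^sub>\<infinity>\<nu>\<in>Sig N. zw_measure z z' w w' N \<nu> * transport_sg N Q t f \<nu>) =
    (\<Sum>\<^sub>\<infinity>\<nu>\<in>Sig N. zw_measure z z' w w' N \<nu> * f \<nu>)"
  proof (cases "K / Z = 0")
    \<comment> \<open>This includes \<open>Z = 0\<close>, where division by zero gives 0 and
      \<open>zw_measure\<close> vanishes identically.\<close>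
    case True
    then show ?thesis unfolding lhs rhs True by simp
  next
    case False
    have "Z = K * (\<Sum>\<^sub>\<infinity>n\<in>Omega N. W n)"
      unfolding Z_def K(2) infsum_cmult_right' reindex ..
    moreover have "Z \<noteq> 0" using False by auto
    ultimately have "(\<Sum>\<^sub>\<infinity>n\<in>Omega N. W n) \<noteq> 0" by auto
    \<comment> \<open>\<open>infsum\<close> takes the value 0 on families that are not summable, so
      a nonzero sum certifies summability.\<close>
    then have summable: "W summable_on Omega N" using infsum_not_exists by blast
    have m0: "m 0 \<noteq> 0" using K(1) False by auto
    have g: "C0 (Omega N) g" unfolding g_def using f by (rule C0_n_to_sig)
    show ?thesis unfolding lhs rhs zw_gen_stationary[OF m0 summable assms(3,4) t g] ..
  qed
qed

end
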